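(* There is a $2$-component welded link with $\mathrm{lk}_{1/2}=\mathrm{lk}_{2/1}=0$ such that the welded link and the trivial $2$-component link are not $4$-equivalent.
   Context: An $m$-component virtual link diagram is the image of an immersion of $m$ circles (ordered and oriented) into the plane whose singularities are only transverse double points, each of which is either a classical crossing (with over/under information) or a virtual crossing (without such information). Welded Reidemeister moves consist of eight types of local moves (together with planar isotopy): the three classical Reidemeister moves; the three virtual Reidemeister moves (the analogues of the Reidemeister moves with all crossings virtual); the mixed move, in which a strand with two virtual crossings is moved across a classical crossing; and the "overcrossings commute" move, in which a strand passing over two other strands at two classical crossings is moved across the virtual crossing of those two strands. An $m$-component welded link is an equivalence class of $m$-component virtual link diagrams under welded Reidemeister moves. The trivial $m$-component link is the class of the diagram of $m$ disjoint circles with no crossings. A $4$-move is the local move on diagrams which replaces two parallel strands without crossings by the two strands twisted around each other with four half-twists (four classical crossings all of the same twisting direction), or the reverse; it is applied irrespective of the orientations of the strands. Two welded links are $4$-equivalent if their diagrams are related by a finite sequence of $4$-moves and welded Reidemeister moves. The $(i,j)$-linking number $\mathrm{lk}_{i/j}$ of a welded link is the sum of the signs, in a diagram of the welded link, of all classical crossings where the $i$th component passes over the $j$th component. *)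

theory Defs
  imports "HOL-Analysis.Analysis"
begin

section \<open>Virtual link diagrams\<close>

text \<open>
  Each of the circles is \<open>\<real>/\<int>\<close>, the plane is \<^typ>\<open>complex\<close>, and a point of the source of the
  immersion is given by a component index and a real parameter. Smoothness is taken to be of class
  \<open>C\<^sup>1\<close>, so that the local moves below can be given by explicit elementary curves.
\<close>

type_synonym point = "nat \<times> real"

text \<open>
  \<open>over D x y\<close> says that \<open>x\<close> and \<open>y\<close> are the two preimages of a classical crossing and that the
  branch through \<open>x\<close> passes over the branch through \<open>y\<close>. A virtual crossing is a double point whose
  two preimages are not related by \<open>over\<close> in either order.
\<close>

record diagram =
  curve :: "nat \<Rightarrow> real \<Rightarrow> complex"
  over :: "point \<Rightarrow> point \<Rightarrow> bool"

definition at_point :: "diagram \<Rightarrow> point \<Rightarrow> complex" where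
  "at_point D x = curve D (fst x) (snd x)"

definition velocity :: "diagram \<Rightarrow> point \<Rightarrow> complex" where
  "velocity D x = vector_derivative (curve D (fst x)) (at (snd x))"

definition source :: "nat \<Rightarrow> point set" where
  "source m = {1..m} \<times> UNIV"

definition same_point :: "point \<Rightarrow> point \<Rightarrow> bool" where
  "same_point x y \<longleftrightarrow> fst x = fst y \<and> snd x - snd y \<in> \<int>"

text \<open>\<open>planar_det v w\<close> is the determinant of the real \<open>2 \<times> 2\<close> matrix with columns \<open>v\<close> and \<open>w\<close>.\<close>

definition planar_det :: "complex \<Rightarrow> complex \<Rightarrow> real" where
  "planar_det v w = Re v * Im w - Im v * Re w"

definition closed_immersion :: "(real \<Rightarrow> complex) \<Rightarrow> bool" where
  "closed_immersion f \<longleftrightarrow>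
     (\<forall>t. f (t + 1) = f t) \<and> f C1_differentiable_on UNIV \<and>
     (\<forall>t. vector_derivative f (at t) \<noteq> 0)"

definition crossing_points :: "nat \<Rightarrow> diagram \<Rightarrow> complex set" where
  "crossing_points m D =
     {at_point D x |x. x \<in> source m \<and>
        (\<exists>y \<in> source m. \<not> same_point x y \<and> at_point D x = at_point D y)}"

definition virtual_diagram :: "nat \<Rightarrow> diagram \<Rightarrow> bool" where
  "virtual_diagram m D \<longleftrightarrow>
     (\<forall>i \<in> {1..m}. closed_immersion (curve D i)) \<and>
     finite (crossing_points m D) \<and>
     (\<forall>x \<in> source m. \<forall>y \<in> source m.
        \<not> same_point x y \<longrightarrow> at_point D x = at_point D y \<longrightarrow>
        planar_det (velocity D x) (velocity D y) \<noteq> 0) \<and>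
     (\<forall>x \<in> source m. \<forall>y \<in> source m. \<forall>z \<in> source m.
        at_point D x = at_point D y \<longrightarrow> at_point D y = at_point D z \<longrightarrow>
        same_point x y \<or> same_point y z \<or> same_point x z) \<and>
     (\<forall>x \<in> source m. \<forall>y \<in> source m. over D x y \<longrightarrow>
        \<not> same_point x y \<and> at_point D x = at_point D y \<and> \<not> over D y x) \<and>
     (\<forall>x \<in> source m. \<forall>x' \<in> source m. \<forall>y \<in> source m. \<forall>y' \<in> source m.
        same_point x x' \<longrightarrow> same_point y y' \<longrightarrow> over D x y = over D x' y')"

definition unlink_diagram :: diagram where
  "unlink_diagram =
     \<lparr>curve = (\<lambda>i t. of_real (3 * real i) + cis (2 * pi * t)), over = (\<lambda>_ _. False)\<rparr>"

text \<open>
  A classical crossing is positive if turning the direction of the over strand counterclockwise by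
  an angle less than \<open>\<pi>\<close> gives the direction of the under strand.
\<close>

definition crossing_sign :: "diagram \<Rightarrow> point \<Rightarrow> point \<Rightarrow> int" where
  "crossing_sign D x y = (if planar_det (velocity D x) (velocity D y) > 0 then 1 else - 1)"

definition lk :: "diagram \<Rightarrow> nat \<Rightarrow> nat \<Rightarrow> int" where
  "lk D i j =
     (\<Sum>(s, t) \<in> {(s, t). s \<in> {0..<1} \<and> t \<in> {0..<1} \<and> over D (i, s) (j, t)}.
        crossing_sign D (i, s) (j, t))"


section \<open>Reparametrization and planar isotopy\<close>

definition reparametrized :: "nat \<Rightarrow> diagram \<Rightarrow> diagram \<Rightarrow> bool" where
  "reparametrized m D D' \<longleftrightarrow> (\<exists>\<rho> :: nat \<Rightarrow> real \<Rightarrow> real.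
     (\<forall>i \<in> {1..m}. \<forall>t. \<rho> i (t + 1) = \<rho> i t + 1 \<and>
        (\<exists>r > 0. (\<rho> i has_real_derivative r) (at t)) \<and>
        curve D' i t = curve D i (\<rho> i t)) \<and>
     (\<forall>(i, s) \<in> source m. \<forall>(j, t) \<in> source m.
        over D' (i, s) (j, t) \<longleftrightarrow> over D (i, \<rho> i s) (j, \<rho> j t)))"

text \<open>
  A \<open>C\<^sup>1\<close> ambient isotopy of the plane. As the derivatives are invertible and depend continuously on
  \<open>u\<close>, all \<open>H u\<close> preserve the orientation.
\<close>

definition planar_isotopy :: "(real \<Rightarrow> complex \<Rightarrow> complex) \<Rightarrow> bool" where
  "planar_isotopy H \<longleftrightarrow>
     (\<forall>z. H 0 z = z) \<and> (\<forall>u \<in> {0..1}. bij (H u)) \<and>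
     continuous_on ({0..1} \<times> UNIV) (\<lambda>(u, z). H u z) \<and>
     (\<exists>H' :: real \<Rightarrow> complex \<Rightarrow> complex \<Rightarrow>\<^sub>L complex.
        (\<forall>u \<in> {0..1}. \<forall>z. (H u has_derivative blinfun_apply (H' u z)) (at z) \<and>
           bij (blinfun_apply (H' u z))) \<and>
        continuous_on ({0..1} \<times> UNIV) (\<lambda>(u, z). H' u z))"

definition isotopic :: "nat \<Rightarrow> diagram \<Rightarrow> diagram \<Rightarrow> bool" where
  "isotopic m D D' \<longleftrightarrow> (\<exists>H. planar_isotopy H \<and>
     (\<forall>x \<in> source m. at_point D' x = H 1 (at_point D x)) \<and>
     (\<forall>x \<in> source m. \<forall>y \<in> source m. over D' x y \<longleftrightarrow> over D x y))"


section \<open>Local moves\<close>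

text \<open>
  A local move replaces the part of a diagram inside a disc. Up to planar isotopy the disc may be
  taken to be the following square. The part inside the square is described by the list \<open>A\<close> of its
  strands, each parametrized by \<open>[-1, 1]\<close>, together with a rule \<open>R\<close> that says which of
  the crossings are classical and with which over/under information: the strand through \<open>x\<close>
  passes over the one through \<open>y\<close> iff \<open>x\<close> and \<open>y\<close> are the preimages of a crossing and \<open>R x y\<close>.
\<close>

definition square :: "complex set" where
  "square = {z. \<bar>Re z\<bar> \<le> 1 \<and> \<bar>Im z\<bar> \<le> 1}"

definition strand_points :: "(real \<Rightarrow> complex) list \<Rightarrow> point set" where
  "strand_points A = {..<length A} \<times> {-1..1}"

text \<open>
  Strand \<open>k\<close> of the local picture is traversed by component \<open>c k\<close> of the diagram, during the
  parameter interval with centre \<open>a k\<close> and half-length \<open>\<bar>b k\<bar>\<close>, in reverse direction if \<open>b k < 0\<close>.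
\<close>

definition place :: "(nat \<Rightarrow> nat) \<Rightarrow> (nat \<Rightarrow> real) \<Rightarrow> (nat \<Rightarrow> real) \<Rightarrow> point \<Rightarrow> point" where
  "place c a b = (\<lambda>(k, s). (c k, a k + b k * s))"

definition in_strands :: "(real \<Rightarrow> complex) list \<Rightarrow> (point \<Rightarrow> point) \<Rightarrow> point \<Rightarrow> bool" where
  "in_strands A e x \<longleftrightarrow> (\<exists>p \<in> strand_points A. same_point x (e p))"

definition meets_square_in ::
  "nat \<Rightarrow> diagram \<Rightarrow> (point \<Rightarrow> point) \<Rightarrow> (real \<Rightarrow> complex) list \<Rightarrow> (point \<Rightarrow> point \<Rightarrow> bool) \<Rightarrow> bool"
where
  "meets_square_in m D e A R \<longleftrightarrow>
     (\<forall>p \<in> strand_points A. e p \<in> source m \<and> at_point D (e p) = (A ! fst p) (snd p)) \<and>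
     (\<forall>p \<in> strand_points A. \<forall>q \<in> strand_points A. same_point (e p) (e q) \<longrightarrow> p = q) \<and>
     (\<forall>x \<in> source m. at_point D x \<in> square \<longrightarrow> in_strands A e x) \<and>
     (\<forall>p \<in> strand_points A. \<forall>q \<in> strand_points A.
        over D (e p) (e q) \<longleftrightarrow>
        p \<noteq> q \<and> (A ! fst p) (snd p) = (A ! fst q) (snd q) \<and> R p q)"

text \<open>The strand lists \<open>A\<close> and \<open>B\<close> have the same length in all uses.\<close>

definition local_move ::
  "nat \<Rightarrow> (real \<Rightarrow> complex) list \<Rightarrow> (real \<Rightarrow> complex) list \<Rightarrow> (point \<Rightarrow> point \<Rightarrow> bool) \<Rightarrow>
   diagram \<Rightarrow> diagram \<Rightarrow> bool"
where
  "local_move m A B R D D' \<longleftrightarrow> (\<exists>c a b.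
     (\<forall>k < length A. b k \<noteq> 0) \<and>
     meets_square_in m D (place c a b) A R \<and> meets_square_in m D' (place c a b) B R \<and>
     (\<forall>x \<in> source m. \<not> in_strands A (place c a b) x \<longrightarrow> at_point D' x = at_point D x) \<and>
     (\<forall>x \<in> source m. \<forall>y \<in> source m.
        \<not> in_strands A (place c a b) x \<longrightarrow> \<not> in_strands A (place c a b) y \<longrightarrow>
        (over D' x y \<longleftrightarrow> over D x y)))"

definition graph_arc :: "(real \<Rightarrow> real) \<Rightarrow> real \<Rightarrow> complex" where
  "graph_arc f s = Complex s (f s)"

text \<open>\<open>curl\<close> has one double point, with preimages \<open>s = -1/2\<close> and \<open>s = 1/2\<close>.\<close>

definition curl :: "(real \<Rightarrow> complex) list" where
  "curl = [\<lambda>s. Complex (s - 16/9 * s * (1 - s\<^sup>2)\<^sup>2) ((1 - s\<^sup>2)\<^sup>2 / 2)]"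

definition straight :: "(real \<Rightarrow> complex) list" where
  "straight = [graph_arc (\<lambda>s. 0)]"

definition parallel :: "(real \<Rightarrow> complex) list" where
  "parallel = [graph_arc (\<lambda>s. 1/2), graph_arc (\<lambda>s. - 1/2)]"

definition bigon :: "(real \<Rightarrow> complex) list" where
  "bigon = [graph_arc (\<lambda>s. - cos (pi * s) / 2), graph_arc (\<lambda>s. cos (pi * s) / 2)]"

definition four_twist :: "(real \<Rightarrow> complex) list" where
  "four_twist = [graph_arc (\<lambda>s. cos (2 * pi * s) / 2), graph_arc (\<lambda>s. - cos (2 * pi * s) / 2)]"

text \<open>Strands 0 and 1 cross at the origin; strand 2 passes above or below this crossing.\<close>

definition triangle_above :: "(real \<Rightarrow> complex) list" where
  "triangle_above =
     [graph_arc (\<lambda>s. s / 2), graph_arc (\<lambda>s. - s / 2), graph_arc (\<lambda>s. (1 + cos (pi * s)) / 4)]"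

definition triangle_below :: "(real \<Rightarrow> complex) list" where
  "triangle_below =
     [graph_arc (\<lambda>s. s / 2), graph_arc (\<lambda>s. - s / 2), graph_arc (\<lambda>s. - (1 + cos (pi * s)) / 4)]"

definition all_virtual :: "point \<Rightarrow> point \<Rightarrow> bool" where
  "all_virtual p q \<longleftrightarrow> False"

definition layered :: "(nat \<Rightarrow> nat) \<Rightarrow> point \<Rightarrow> point \<Rightarrow> bool" where
  "layered h p q \<longleftrightarrow> h (fst q) < h (fst p)"

text \<open>
  All four half-twists have the same direction iff the over strand has slope of the same sign at
  each of the four crossings.
\<close>

definition over_slope :: "real \<Rightarrow> point \<Rightarrow> point \<Rightarrow> bool" where
  "over_slope \<epsilon> p q \<longleftrightarrow> \<epsilon> * deriv (\<lambda>s. Im ((four_twist ! fst p) s)) (snd p) > 0"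

text \<open>
  Each move is given in one direction only; the strands may be oriented in any way, because of
  the sign of \<open>b\<close> in \<^const>\<open>local_move\<close>, and the other planar positions of the
  moves arise from rotating the square.
\<close>

inductive welded_step :: "nat \<Rightarrow> diagram \<Rightarrow> diagram \<Rightarrow> bool" for m where
  reparametrization: "reparametrized m D D' \<Longrightarrow> welded_step m D D'"
| isotopy: "isotopic m D D' \<Longrightarrow> welded_step m D D'"
| R1_neg: "local_move m curl straight (\<lambda>p q. snd p < snd q) D D' \<Longrightarrow> welded_step m D D'"
| R1_pos: "local_move m curl straight (\<lambda>p q. snd q < snd p) D D' \<Longrightarrow> welded_step m D D'"
| R2: "inj h \<Longrightarrow> local_move m bigon parallel (layered h) D D' \<Longrightarrow> welded_step m D D'"
| R3: "inj h \<Longrightarrow> local_move m triangle_above triangle_below (layered h) D D'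
    \<Longrightarrow> welded_step m D D'"
| V1: "local_move m curl straight all_virtual D D' \<Longrightarrow> welded_step m D D'"
| V2: "local_move m bigon parallel all_virtual D D' \<Longrightarrow> welded_step m D D'"
| V3: "local_move m triangle_above triangle_below all_virtual D D' \<Longrightarrow> welded_step m D D'"
| mixed: "{k, l} = {0, 1} \<Longrightarrow>
    local_move m triangle_above triangle_below (\<lambda>p q. fst p = k \<and> fst q = l) D D'
    \<Longrightarrow> welded_step m D D'"
| overcrossings_commute:
    "local_move m triangle_above triangle_below (\<lambda>p q. fst p = 2 \<and> fst q \<in> {0, 1}) D D'
    \<Longrightarrow> welded_step m D D'"

definition four_move :: "nat \<Rightarrow> diagram \<Rightarrow> diagram \<Rightarrow> bool" where
  "four_move m D D' \<longleftrightarrow>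
     (\<exists>\<epsilon> \<in> {1, - 1}. local_move m four_twist parallel (over_slope \<epsilon>) D D')"


section \<open>Welded links and 4-equivalence\<close>

definition related_by ::
  "nat \<Rightarrow> (diagram \<Rightarrow> diagram \<Rightarrow> bool) \<Rightarrow> diagram \<Rightarrow> diagram \<Rightarrow> bool"
where
  "related_by m step =
     equivclp (\<lambda>D D'. virtual_diagram m D \<and> virtual_diagram m D' \<and> step D D')"

definition welded_rel :: "nat \<Rightarrow> diagram rel" where
  "welded_rel m =
     {(D, D'). virtual_diagram m D \<and> virtual_diagram m D' \<and> related_by m (welded_step m) D D'}"

definition welded_links :: "nat \<Rightarrow> diagram set set" where
  "welded_links m = {D. virtual_diagram m D} // welded_rel m"

definition trivial_link :: "nat \<Rightarrow> diagram set" where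
  "trivial_link m = welded_rel m `` {unlink_diagram}"

definition four_equivalent :: "nat \<Rightarrow> diagram set \<Rightarrow> diagram set \<Rightarrow> bool" where
  "four_equivalent m L L' \<longleftrightarrow>
     (\<exists>D \<in> L. \<exists>D' \<in> L'. related_by m (\<lambda>E E'. welded_step m E E' \<or> four_move m E E') D D')"

end

theory Submission
  imports Defs
begin

text \<open>
  Let \<open>Q\<close> be the quotient of the ring \<open>F[x, y]\<close> over the field \<open>F\<close> with two elements by the relations
  \<open>x\<^sup>2 = y\<^sup>2 = x y\<close> and the vanishing of all cubic terms. Sending the meridians of the first component
  to affine maps of \<open>Q\<close> with linear part \<open>1 + x\<close>, and those of the second to affine maps with linear
  part \<open>1 + y\<close>, gives Wirtinger colorings; since \<open>(g h)\<^sup>2\<close> and \<open>(g h\<^sup>-\<^sup>1)\<^sup>2\<close> commute with \<open>g\<close> and \<open>h\<close> for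
  any two such meridians, a 4-move does not change them. If the constant terms of the translation parts
  differ on the two components, then only two bits of the color of an arc matter: \<open>A\<close>, the sum of the two
  coefficients in degree one, and \<open>r\<close>, the coefficient in degree two. The existence of a coloring by
  such pairs is an invariant of 4-equivalence. The trivial link has one, but on a link where each component passes under the other one twice, with opposite signs and
  interleaved, following the first component once around changes \<open>r\<close>.
\<close>

section \<open>Colorings of diagrams\<close>

text \<open>Conjugating the meridian v -> (1 + x) v + a by v -> (1 + y) v + b replaces a by (1 + y)
  a + x b, and conjugating by the inverse replaces it by (1 + y + y^2) a + (x + x y) b. Both keep
  the constant term of a and add the sum of the constant terms of a and b to \<open>A\<close>. The
  coefficient \<open>r\<close> grows by the sum of the values \<open>A\<close> of a and b, and for
  the inverse once more by the sum of the constant terms. The latter sum is 0 within a component and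
  1 between the two; it is the flag \<open>i\<close> of \<open>act\<close>, whose formula is thereby
  explained. The remaining obstacle is geometric. Diagrams consist of real curves, so there is no
  list of arcs; colors are attached to parameters, and arcs appear only through local constancy. For
  a local move it suffices to know which colors at the ends of the strands extend over the picture
  in the square. All pictures except the curl consist of graphs of functions; reading these from
  left to right reduces the question to words in crossings.\<close>

type_synonym color = "bool \<times> bool"

text \<open>
  \<open>act i d u w\<close> is the color of an arc after it passes under an arc of color \<open>w\<close>, where \<open>i\<close> says that the
  arcs belong to different components and \<open>d\<close> that the crossing is negative; \<open>\<noteq>\<close> on
  \<^typ>\<open>bool\<close> serves as addition modulo 2.
\<close>

definition act :: "bool \<Rightarrow> bool \<Rightarrow> color \<Rightarrow> color \<Rightarrow> color" where
  "act i d u w = (fst u \<noteq> i, snd u \<noteq> (fst u \<noteq> (fst w \<noteq> (i \<and> d))))"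

text \<open>A step changes \<open>A\<close> by \<open>i\<close>, so the way back sees a value of
  \<open>A\<close> that differs by \<open>i\<close>; the summand \<open>i \<and> d\<close> of
  \<open>act\<close> compensates exactly for this.\<close>

lemma act_inverse: "act i (\<not> d) (act i d u w) w = u"
  by (cases u; cases w) (auto simp: act_def)

lemma act_inverse': "d' = (\<not> d) \<Longrightarrow> act i d' (act i d u w) w = u"
  by (simp add: act_inverse)

lemma act_self: "act False d u u = u"
  by (cases u) (auto simp: act_def)

text \<open>Serves kinks whose over arc is the one leaving the undercrossing, where idempotence has
  to be read backwards.\<close>

lemma act_eq_self: "act False d u w = w \<Longrightarrow> u = w"
  by (cases u; cases w) (auto simp: act_def)

text \<open>Self-distributivity, the algebraic form of the third Reidemeister move. The three flags
  compare three strands pairwise; as each strand either belongs to component 1 or not, one flag is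
  the sum of the other two.\<close>

lemma act_distrib:
  assumes "i \<longleftrightarrow> (j \<noteq> k)"
  shows "act i d (act j e u v) w = act j e (act i d u w) (act k d v w)"
  using assms by (cases u; cases v; cases w) (auto simp: act_def)

lemma act_commute:
  "act i d (act j e u w) w = act j e (act i d u w) w" if "i = j"
  using that by (cases u; cases w) (auto simp: act_def)

section \<open>One-sided limits of colors at an undercrossing\<close>

definition jump :: "(real \<Rightarrow> color) \<Rightarrow> real \<Rightarrow> bool \<Rightarrow> bool \<Rightarrow> color \<Rightarrow> bool" where
  "jump f t i d w \<longleftrightarrow>
     (\<exists>u. (\<forall>\<^sub>F s in at_left t. f s = u) \<and> (\<forall>\<^sub>F s in at_right t. f s = act i d u w))"

lemma jump_cong:
  assumes "\<forall>\<^sub>F s in at t. f s = g s"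
  shows "jump f t i d w \<longleftrightarrow> jump g t i d w"
proof -
  have l: "\<forall>\<^sub>F s in at_left t. f s = g s" and r: "\<forall>\<^sub>F s in at_right t. f s = g s"
    using assms by (auto simp: eventually_at_split)
  have "(\<forall>\<^sub>F s in at_left t. f s = u) \<longleftrightarrow> (\<forall>\<^sub>F s in at_left t. g s = u)" for u
    using l by (rule eventually_cong) auto
  moreover have "(\<forall>\<^sub>F s in at_right t. f s = u) \<longleftrightarrow> (\<forall>\<^sub>F s in at_right t. g s = u)" for u
    using r by (rule eventually_cong) auto
  ultimately show ?thesis by (simp add: jump_def)
qed

lemma jump_increasing:
  assumes "isCont g t" "\<And>x y. x < y \<Longrightarrow> g x < g y" "jump f (g t) i d w"
  shows "jump (\<lambda>s. f (g s)) t i d w"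
proof -
  have lim: "(g \<longlongrightarrow> g t) (at_left t)" "(g \<longlongrightarrow> g t) (at_right t)"
    using assms(1) by (auto simp: isCont_def filterlim_at_split)
  have l: "filterlim g (at_left (g t)) (at_left t)"
    unfolding filterlim_at using lim assms(2)
    by (force simp: eventually_at_left_field intro: exI[of _ "t - 1"])
  have r: "filterlim g (at_right (g t)) (at_right t)"
    unfolding filterlim_at using lim assms(2)
    by (force simp: eventually_at_right_field intro: exI[of _ "t + 1"])
  show ?thesis
    using assms(3) l r unfolding jump_def filterlim_iff by blast
qed

text \<open>Reversal exchanges the two sides of the jump, and by \<open>act_inverse\<close> the step
  in the other direction is a step of opposite sign.\<close>

lemma jump_decreasing:
  assumes "isCont g t" "\<And>x y. x < y \<Longrightarrow> g y < g x" "jump f (g t) i d w"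
  shows "jump (\<lambda>s. f (g s)) t i (\<not> d) w"
proof -
  have lim: "(g \<longlongrightarrow> g t) (at_left t)" "(g \<longlongrightarrow> g t) (at_right t)"
    using assms(1) by (auto simp: isCont_def filterlim_at_split)
  have l: "filterlim g (at_right (g t)) (at_left t)"
    unfolding filterlim_at using lim assms(2)
    by (force simp: eventually_at_left_field intro: exI[of _ "t - 1"])
  have r: "filterlim g (at_left (g t)) (at_right t)"
    unfolding filterlim_at using lim assms(2)
    by (force simp: eventually_at_right_field intro: exI[of _ "t + 1"])
  obtain u where "\<forall>\<^sub>F s in at_left (g t). f s = u" "\<forall>\<^sub>F s in at_right (g t). f s = act i d u w"
    using assms(3) by (auto simp: jump_def)
  then have "\<forall>\<^sub>F s in at_right t. f (g s) = u" "\<forall>\<^sub>F s in at_left t. f (g s) = act i d u w"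
    using l r unfolding filterlim_iff by blast+
  then show ?thesis
    unfolding jump_def by (intro exI[of _ "act i d u w"]) (simp add: act_inverse)
qed

lemma jump_affine:
  assumes "\<beta> \<noteq> 0" "jump f (\<alpha> + \<beta> * t) i d w"
  shows "jump (\<lambda>s. f (\<alpha> + \<beta> * s)) t i (d \<noteq> (\<beta> < 0)) w"
proof (cases "\<beta> < 0")
  case True
  have "jump (\<lambda>s. f ((\<lambda>s. \<alpha> + \<beta> * s) s)) t i (\<not> d) w"
    by (rule jump_decreasing) (use True assms in auto)
  with True show ?thesis by simp
next
  case False
  have "jump (\<lambda>s. f ((\<lambda>s. \<alpha> + \<beta> * s) s)) t i d w"
    by (rule jump_increasing) (use False assms in auto)
  with False show ?thesis by simp
qed

lemma jump_const: "act i d u w = u \<Longrightarrow> jump (\<lambda>_. u) t i d w"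
  by (auto simp: jump_def)

text \<open>The value at an undercrossing parameter is left free, since two arcs end there; only the
  colors on its two sides are related. Virtual crossings impose nothing. For \<open>m > 2\<close>
  all components other than 1 are treated alike.\<close>

definition coloring :: "nat \<Rightarrow> diagram \<Rightarrow> (point \<Rightarrow> color) \<Rightarrow> bool" where
  "coloring m D f \<longleftrightarrow>
     (\<forall>x \<in> source m. \<forall>y \<in> source m. same_point x y \<longrightarrow> f x = f y) \<and>
     (\<forall>x \<in> source m. (\<forall>y \<in> source m. \<not> over D y x) \<longrightarrow>
        (\<forall>\<^sub>F t in at (snd x). f (fst x, t) = f x)) \<and>
     (\<forall>x \<in> source m. \<forall>y \<in> source m. over D y x \<longrightarrow>
        jump (\<lambda>t. f (fst x, t)) (snd x) ((fst x = 1) \<noteq> (fst y = 1))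
          (planar_det (velocity D y) (velocity D x) < 0) (f y))"

lemma coloringD:
  assumes "coloring m D f" "x \<in> source m"
  shows "y \<in> source m \<Longrightarrow> same_point x y \<Longrightarrow> f x = f y"
    and "(\<And>y. y \<in> source m \<Longrightarrow> \<not> over D y x) \<Longrightarrow> \<forall>\<^sub>F t in at (snd x). f (fst x, t) = f x"
    and "y \<in> source m \<Longrightarrow> over D y x \<Longrightarrow>
        jump (\<lambda>t. f (fst x, t)) (snd x) ((fst x = 1) \<noteq> (fst y = 1))
          (planar_det (velocity D y) (velocity D x) < 0) (f y)"
  using assms unfolding coloring_def by blast+

lemma virtual_diagramD:
  assumes "virtual_diagram m D"
  shows "i \<in> {1..m} \<Longrightarrow> closed_immersion (curve D i)"
    and "x \<in> source m \<Longrightarrow> y \<in> source m \<Longrightarrow> over D x y \<Longrightarrow>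
      \<not> same_point x y \<and> at_point D x = at_point D y \<and> \<not> over D y x"
    and "x \<in> source m \<Longrightarrow> y \<in> source m \<Longrightarrow> over D x y \<Longrightarrow>
      planar_det (velocity D x) (velocity D y) \<noteq> 0"
    and "x \<in> source m \<Longrightarrow> x' \<in> source m \<Longrightarrow> y \<in> source m \<Longrightarrow> y' \<in> source m \<Longrightarrow>
      same_point x x' \<Longrightarrow> same_point y y' \<Longrightarrow> over D x y = over D x' y'"
  using assms unfolding virtual_diagram_def by blast+

lemma curve_has_vector_derivative:
  assumes "virtual_diagram m D" "x \<in> source m"
  shows "(curve D (fst x) has_vector_derivative velocity D x) (at (snd x))"
proof -
  have "closed_immersion (curve D (fst x))"
    using assms virtual_diagramD(1)[OF assms(1)] by (auto simp: source_def mem_Times_iff)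
  then show ?thesis
    by (auto simp: closed_immersion_def C1_differentiable_on_eq velocity_def
        intro: vector_derivative_works[THEN iffD1])
qed

lemma planar_det_scaleR: "planar_det (a *\<^sub>R v) (b *\<^sub>R w) = a * b * planar_det v w"
  by (simp add: planar_det_def algebra_simps)

text \<open>Stated with a general increment so that it covers both lifts of circle maps
  (\<open>c = 1\<close>) and closed curves in the plane (\<open>c = 0\<close>).\<close>

lemma int_shift:
  fixes \<rho> :: "real \<Rightarrow> 'a :: real_normed_algebra_1"
  assumes "\<And>t. \<rho> (t + 1) = \<rho> t + c"
  shows "\<rho> (t + of_int n) = \<rho> t + of_int n * c"
proof -
  have pos: "\<rho> (t + real k) = \<rho> t + of_nat k * c" for t and k :: nat
  proof (induction k)
    case (Suc k)
    have "\<rho> (t + real (Suc k)) = \<rho> ((t + real k) + 1)" by (simp add: algebra_simps)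
    also have "\<dots> = \<rho> (t + real k) + c" by (rule assms)
    finally show ?case using Suc by (simp add: algebra_simps)
  qed simp
  show ?thesis
  proof (cases "n \<ge> 0")
    case True
    then show ?thesis using pos[of t "nat n"] by simp
  next
    case False
    then show ?thesis using pos[of "t + of_int n" "nat (- n)"] by simp
  qed
qed

lemma shift_equivariant_surj:
  fixes \<rho> :: "real \<Rightarrow> real"
  assumes shift: "\<And>t. \<rho> (t + 1) = \<rho> t + 1" and cont: "\<And>t. isCont \<rho> t"
  shows "\<exists>t. \<rho> t = y"
proof -
  obtain n :: nat where n: "\<bar>y - \<rho> 0\<bar> \<le> real n" using real_arch_simple by blast
  have "\<rho> (real n) = \<rho> 0 + real n" "\<rho> (- real n) = \<rho> 0 - real n"
    using int_shift[of \<rho> 1 0 "int n"] int_shift[of \<rho> 1 0 "- int n"] shift by auto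
  then have "\<rho> (- real n) \<le> y" "y \<le> \<rho> (real n)" using n by linarith+
  then show ?thesis
    using IVT'[of \<rho> "- real n" y "real n"] cont continuous_at_imp_continuous_on[of _ \<rho>]
    by auto
qed

section \<open>Invariance under reparametrization\<close>

lemma reparametrized_sym:
  assumes "reparametrized m D D'"
  shows "reparametrized m D' D"
proof -
  obtain \<rho> where
    \<rho>: "\<forall>i \<in> {1..m}. \<forall>t. \<rho> i (t + 1) = \<rho> i t + 1 \<and>
        (\<exists>r > 0. (\<rho> i has_real_derivative r) (at t)) \<and> curve D' i t = curve D i (\<rho> i t)"
    and over0: "\<forall>(i, s) \<in> source m. \<forall>(j, t) \<in> source m.
        over D' (i, s) (j, t) \<longleftrightarrow> over D (i, \<rho> i s) (j, \<rho> j t)"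
    using assms unfolding reparametrized_def by (elim exE conjE)
  note shift = \<rho>[rule_format, THEN conjunct1]
    and deriv = \<rho>[rule_format, THEN conjunct2, THEN conjunct1]
    and curve = \<rho>[rule_format, THEN conjunct2, THEN conjunct2]
  have cont: "isCont (\<rho> i) t" if "i \<in> {1..m}" for i t
    using deriv[OF that] DERIV_isCont by blast
  have mono: "\<rho> i s < \<rho> i t" if "i \<in> {1..m}" "s < t" for i s t
    using DERIV_pos_imp_increasing[OF that(2)] deriv[OF that(1)] by blast
  then have inj: "inj (\<rho> i)" if "i \<in> {1..m}" for i
    using that by (metis injI linorder_neqE_linordered_idom order_less_irrefl)
  define \<sigma> where "\<sigma> i = inv (\<rho> i)" for i
  have \<rho>\<sigma>: "\<rho> i (\<sigma> i t) = t" if "i \<in> {1..m}" for i t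
    using shift_equivariant_surj[OF shift cont, OF that that, of t] by (auto simp: \<sigma>_def f_inv_into_f)
  have \<sigma>\<rho>: "\<sigma> i (\<rho> i t) = t" if "i \<in> {1..m}" for i t
    using inj[OF that] by (simp add: \<sigma>_def)
  have s1: "\<sigma> i (t + 1) = \<sigma> i t + 1" if "i \<in> {1..m}" for i t
    using shift[OF that, of "\<sigma> i t"] \<rho>\<sigma>[OF that] \<sigma>\<rho>[OF that] by metis
  have s2: "\<exists>r > 0. (\<sigma> i has_real_derivative r) (at t)" if i: "i \<in> {1..m}" for i t
  proof -
    obtain r where r: "r > 0" "(\<rho> i has_real_derivative r) (at (\<sigma> i t))" using deriv[OF i] by blast
    have "isCont (\<sigma> i) (\<rho> i (\<sigma> i t))"
      by (rule isCont_inverse_function[of 1]) (use \<sigma>\<rho>[OF i] cont[OF i] in auto)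
    then have "(\<sigma> i has_real_derivative inverse r) (at t)"
      using DERIV_inverse_function[of "\<rho> i" r "\<sigma> i" t "t - 1" "t + 1"] r \<rho>\<sigma>[OF i] by auto
    then show ?thesis using r(1) by (intro exI[of _ "inverse r"]) simp
  qed
  have over: "over D (i, s) (j, t) \<longleftrightarrow> over D' (i, \<sigma> i s) (j, \<sigma> j t)"
    if "i \<in> {1..m}" "j \<in> {1..m}" for i j s t
    using bspec[OF bspec[OF over0, of "(i, \<sigma> i s)", simplified], of "(j, \<sigma> j t)"] that \<rho>\<sigma>
    by (simp add: source_def)
  show ?thesis
    unfolding reparametrized_def
  proof (rule exI[of _ \<sigma>], intro conjI ballI allI)
    show "case x of (i, s) \<Rightarrow> \<forall>(j, t)\<in>source m. over D (i, s) (j, t) = over D' (i, \<sigma> i s) (j, \<sigma> j t)"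
      if "x \<in> source m" for x
      using that over by (auto simp: source_def)
  qed (simp_all only: s1 s2 curve \<rho>\<sigma>)
qed

text \<open>The coloring is pulled back along the lifts \<open>\<rho> i\<close>. These increase, so
  sides of jumps are kept, and velocities are only scaled by positive factors, so signs are
  kept.\<close>

lemma coloring_reparametrized:
  assumes "virtual_diagram m D" "reparametrized m D D'" "coloring m D f"
  shows "\<exists>f'. coloring m D' f'"
proof -
  obtain \<rho> where
    \<rho>: "\<forall>i \<in> {1..m}. \<forall>t. \<rho> i (t + 1) = \<rho> i t + 1 \<and>
        (\<exists>r > 0. (\<rho> i has_real_derivative r) (at t)) \<and> curve D' i t = curve D i (\<rho> i t)"
    and over0: "\<forall>(i, s) \<in> source m. \<forall>(j, t) \<in> source m.
        over D' (i, s) (j, t) \<longleftrightarrow> over D (i, \<rho> i s) (j, \<rho> j t)"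
    using assms(2) unfolding reparametrized_def by (elim exE conjE)
  note shift = \<rho>[rule_format, THEN conjunct1]
    and deriv = \<rho>[rule_format, THEN conjunct2, THEN conjunct1]
    and curve = \<rho>[rule_format, THEN conjunct2, THEN conjunct2]
  have over: "over D' (i, s) (j, t) \<longleftrightarrow> over D (i, \<rho> i s) (j, \<rho> j t)"
    if "i \<in> {1..m}" "j \<in> {1..m}" for i j s t
    using bspec[OF bspec[OF over0, of "(i, s)", simplified], of "(j, t)"] that
    by (simp add: source_def)
  have mono: "\<rho> i s < \<rho> i t" if "i \<in> {1..m}" "s < t" for i s t
    using DERIV_pos_imp_increasing[OF that(2)] deriv[OF that(1)] by blast
  have cont: "isCont (\<rho> i) t" if "i \<in> {1..m}" for i t
    using deriv[OF that] DERIV_isCont by blast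
  have vel: "\<exists>r > 0. velocity D' (i, t) = r *\<^sub>R velocity D (i, \<rho> i t)" if i: "i \<in> {1..m}" for i t
  proof -
    obtain r where r: "r > 0" "(\<rho> i has_real_derivative r) (at t)" using deriv[OF i] by blast
    have "(curve D i has_vector_derivative velocity D (i, \<rho> i t)) (at (\<rho> i t))"
      using curve_has_vector_derivative[OF assms(1), of "(i, \<rho> i t)"] i by (simp add: source_def)
    then have "(curve D i \<circ> \<rho> i has_vector_derivative r *\<^sub>R velocity D (i, \<rho> i t)) (at t)"
      using r(2) by (intro vector_diff_chain_at) (auto simp: has_real_derivative_iff_has_vector_derivative)
    moreover have "curve D i \<circ> \<rho> i = curve D' i" using curve[OF i] by auto
    ultimately show ?thesis
      using r(1) by (auto simp: velocity_def intro: vector_derivative_at)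
  qed
  define f' where "f' x = f (fst x, \<rho> (fst x) (snd x))" for x
  have "coloring m D' f'"
    unfolding coloring_def
  proof (intro conjI ballI impI)
    fix x y assume "x \<in> source m" "y \<in> source m" and s: "same_point x y"
    then obtain i s t where x: "x = (i, s)" "y = (i, t)" and i: "i \<in> {1..m}" and "s - t \<in> \<int>"
      by (auto simp: same_point_def source_def)
    then obtain n where "s - t = of_int n" by (auto elim: Ints_cases)
    then have "s = t + of_int n" by simp
    then have "same_point (i, \<rho> i s) (i, \<rho> i t)"
      using int_shift[of "\<rho> i" 1] shift[OF i] by (simp add: same_point_def)
    then show "f' x = f' y"
      using coloringD(1)[OF assms(3)] i by (simp add: x f'_def source_def)
  next
    fix x assume "x \<in> source m" and nu: "\<forall>y \<in> source m. \<not> over D' y x"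
    then obtain i s where x: "x = (i, s)" and i: "i \<in> {1..m}" by (auto simp: source_def)
    \<comment> \<open>Surjectivity of the lifts enters here: an over branch of \<open>D\<close> at
      this point would come from one of \<open>D'\<close>.\<close>
    have "\<not> over D y (i, \<rho> i s)" if "y \<in> source m" for y
    proof -
      obtain j t where y: "y = (j, t)" and j: "j \<in> {1..m}" using \<open>y \<in> source m\<close>
        by (auto simp: source_def)
      obtain t' where t': "\<rho> j t' = t" using shift_equivariant_surj[OF shift cont, OF j j] by blast
      then show ?thesis
        using nu over[OF j i, of t' s] j by (simp add: x y source_def)
    qed
    then have "\<forall>\<^sub>F t in at (\<rho> i s). f (i, t) = f (i, \<rho> i s)"
      using coloringD(2)[OF assms(3), of "(i, \<rho> i s)"] i by (simp add: source_def)
    moreover have "filterlim (\<rho> i) (at (\<rho> i s)) (at s)"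
    proof -
      have "\<rho> i t \<noteq> \<rho> i s" if "t \<noteq> s" for t
        using mono[OF i, of s t] mono[OF i, of t s] that by (cases "s < t") auto
      then show ?thesis
        unfolding filterlim_at using cont[OF i, of s] by (simp add: isCont_def eventually_at_filter)
    qed
    ultimately have "\<forall>\<^sub>F t in at s. f (i, \<rho> i t) = f (i, \<rho> i s)"
      by (rule eventually_compose_filterlim)
    then show "\<forall>\<^sub>F t in at (snd x). f' (fst x, t) = f' x"
      by (simp add: x f'_def)
  next
    fix x y assume "x \<in> source m" "y \<in> source m" and o: "over D' y x"
    then obtain i s j t where x: "x = (i, s)" "y = (j, t)" and ij: "i \<in> {1..m}" "j \<in> {1..m}"
      by (auto simp: source_def)
    obtain r r' where r: "r > 0" "velocity D' (i, s) = r *\<^sub>R velocity D (i, \<rho> i s)"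
      "r' > 0" "velocity D' (j, t) = r' *\<^sub>R velocity D (j, \<rho> j t)"
      using vel[OF ij(1)] vel[OF ij(2)] by blast
    have "over D (j, \<rho> j t) (i, \<rho> i s)" using o over[OF ij(2,1)] by (simp add: x)
    then have "jump (\<lambda>t. f (i, t)) (\<rho> i s) ((i = 1) \<noteq> (j = 1))
          (planar_det (velocity D (j, \<rho> j t)) (velocity D (i, \<rho> i s)) < 0) (f (j, \<rho> j t))"
      using coloringD(3)[OF assms(3), of "(i, \<rho> i s)" "(j, \<rho> j t)"] ij by (simp add: source_def)
    then have "jump (\<lambda>t. f (i, \<rho> i t)) s ((i = 1) \<noteq> (j = 1))
          (planar_det (velocity D (j, \<rho> j t)) (velocity D (i, \<rho> i s)) < 0) (f (j, \<rho> j t))"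
      using jump_increasing[OF cont[OF ij(1)] mono[OF ij(1)]] by simp
    then show "jump (\<lambda>t. f' (fst x, t)) (snd x) ((fst x = 1) \<noteq> (fst y = 1))
          (planar_det (velocity D' y) (velocity D' x) < 0) (f' y)"
      using r by (simp add: x f'_def planar_det_scaleR mult_less_0_iff)
  qed
  then show ?thesis by blast
qed

section \<open>Invariance under planar isotopy\<close>

lemma planar_det_linear:
  assumes "linear L"
  shows "planar_det (L v) (L w) = planar_det (L 1) (L \<i>) * planar_det v w"
proof -
  have "L z = Re z *\<^sub>R L 1 + Im z *\<^sub>R L \<i>" for z
  proof -
    have "L z = L (Re z *\<^sub>R 1 + Im z *\<^sub>R \<i>)"
      by (rule arg_cong[of _ _ L]) (simp add: complex_eq_iff)
    then show ?thesis by (simp only: linear_add[OF assms] linear_scale[OF assms])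
  qed
  from this[of v] this[of w] show ?thesis
    by (simp only: planar_det_def) (simp add: algebra_simps)
qed

text \<open>At a fixed point of the plane the determinant of the derivative of \<open>H u\<close>
  depends continuously on \<open>u\<close>, never vanishes, and is 1 at \<open>u = 0\<close>; by the
  intermediate value theorem it is positive at \<open>u = 1\<close>.\<close>

lemma planar_isotopy_det:
  assumes "planar_isotopy H"
  shows "\<exists>L. (\<forall>z. (H 1 has_derivative L z) (at z)) \<and>
    (\<forall>z v w. planar_det (L z v) (L z w) < 0 \<longleftrightarrow> planar_det v w < 0)"
proof -
  from assms obtain H' :: "real \<Rightarrow> complex \<Rightarrow> complex \<Rightarrow>\<^sub>L complex" where
    H0: "\<And>z. H 0 z = z" and
    H': "\<And>u z. u \<in> {0..1} \<Longrightarrow> (H u has_derivative blinfun_apply (H' u z)) (at z)"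
      "\<And>u z. u \<in> {0..1} \<Longrightarrow> bij (blinfun_apply (H' u z))" and
    cont: "continuous_on ({0..1} \<times> UNIV) (\<lambda>(u, z). H' u z)"
    unfolding planar_isotopy_def by blast
  define \<delta> where "\<delta> u z = planar_det (H' u z 1) (H' u z \<i>)" for u z
  have det: "planar_det (H' u z v) (H' u z w) = \<delta> u z * planar_det v w" for u z v w
    unfolding \<delta>_def by (rule planar_det_linear) (rule bounded_linear.linear[OF blinfun.bounded_linear_right])
  have nz: "\<delta> u z \<noteq> 0" if u: "u \<in> {0..1}" for u z
  proof
    assume 0: "\<delta> u z = 0"
    obtain v w where "1 = H' u z v" "\<i> = H' u z w"
      using bij_is_surj[OF H'(2)[OF u, of z]] surjD by metis
    then show False using det[of u z v w] 0 by (simp add: planar_det_def)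
  qed
  have pos: "\<delta> 1 z > 0" for z
  proof (rule ccontr)
    assume neg: "\<not> \<delta> 1 z > 0"
    have "H 0 = (\<lambda>z. z)" using H0 by auto
    then have "(H 0 has_derivative (\<lambda>h. h)) (at z)" by simp
    then have "blinfun_apply (H' 0 z) = (\<lambda>h. h)"
      using H'(1)[of 0 z] has_derivative_unique by auto
    then have "\<delta> 0 z = 1" by (simp add: \<delta>_def planar_det_def)
    moreover have "continuous_on {0..1} (\<lambda>u. H' u z)"
    proof -
      have "continuous_on {0..1} ((\<lambda>(u, z). H' u z) \<circ> (\<lambda>u. (u, z)))"
        by (intro continuous_on_compose continuous_intros continuous_on_subset[OF cont]) auto
      then show ?thesis by (simp add: o_def)
    qed
    then have "continuous_on {0..1} (\<lambda>u. \<delta> u z)"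
      unfolding \<delta>_def planar_det_def by (intro continuous_intros)
    ultimately obtain u where "u \<in> {0..1}" "\<delta> u z = 0"
      using IVT2'[of "\<lambda>u. \<delta> u z" 1 0 0] neg by auto
    then show False using nz by blast
  qed
  show ?thesis
  proof (intro exI[of _ "\<lambda>z. blinfun_apply (H' 1 z)"] conjI allI)
    show "(H 1 has_derivative blinfun_apply (H' 1 z)) (at z)" for z using H'(1) by simp
    show "planar_det (H' 1 z v) (H' 1 z w) < 0 \<longleftrightarrow> planar_det v w < 0" for z v w
      using det[of 1 z v w] pos[of z] by (simp add: mult_less_0_iff)
  qed
qed

text \<open>Colors live on the source, which an isotopy of the plane does not touch; only the signs
  of the crossings have to be compared.\<close>

lemma coloring_isotopic:
  assumes "virtual_diagram m D" "isotopic m D D'"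
  shows "coloring m D' f \<longleftrightarrow> coloring m D f"
proof -
  obtain H where H: "planar_isotopy H"
    and "\<forall>x \<in> source m. at_point D' x = H 1 (at_point D x)"
    and "\<forall>x \<in> source m. \<forall>y \<in> source m. over D' x y \<longleftrightarrow> over D x y"
    using assms(2) unfolding isotopic_def by (elim exE conjE)
  note pt = this(2)[rule_format] and over = this(3)[rule_format]
  obtain L where "\<forall>z. (H 1 has_derivative L z) (at z)"
    "\<forall>z v w. planar_det (L z v) (L z w) < 0 \<longleftrightarrow> planar_det v w < 0"
    using planar_isotopy_det[OF H] by (elim exE conjE)
  note L = this[rule_format]
  have vel: "velocity D' x = L (at_point D x) (velocity D x)" if "x \<in> source m" for x
  proof -
    have "(H 1 \<circ> curve D (fst x) has_derivative L (at_point D x) \<circ> (\<lambda>h. h *\<^sub>R velocity D x))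
        (at (snd x))"
      using curve_has_vector_derivative[OF assms(1) that] L(1)[of "at_point D x"]
      by (intro diff_chain_at) (simp_all add: has_vector_derivative_def at_point_def)
    then have "(H 1 \<circ> curve D (fst x) has_vector_derivative L (at_point D x) (velocity D x))
        (at (snd x))"
      using linear_scale[OF has_derivative_linear[OF L(1)]]
      by (simp add: has_vector_derivative_def o_def)
    moreover have "H 1 \<circ> curve D (fst x) = curve D' (fst x)"
    proof
      fix t
      have "(fst x, t) \<in> source m" using that by (auto simp: source_def)
      from pt[OF this] show "(H 1 \<circ> curve D (fst x)) t = curve D' (fst x) t"
        by (simp add: at_point_def)
    qed
    ultimately show ?thesis by (auto simp: velocity_def intro: vector_derivative_at)
  qed
  have det: "planar_det (velocity D' y) (velocity D' x) < 0 \<longleftrightarrow>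
      planar_det (velocity D y) (velocity D x) < 0"
    if "x \<in> source m" "y \<in> source m" "over D y x" for x y
    using vel[OF that(1)] vel[OF that(2)] L(2)[of "at_point D x"]
      virtual_diagramD(2)[OF assms(1) that(2,1,3)] by simp
  show ?thesis
    unfolding coloring_def
    by (intro conj_cong ball_cong refl imp_cong; simp add: over det)
qed

section \<open>Colorings and local moves\<close>

definition crosses ::
  "(real \<Rightarrow> complex) list \<Rightarrow> (point \<Rightarrow> point \<Rightarrow> bool) \<Rightarrow> point \<Rightarrow> point \<Rightarrow> bool"
where
  "crosses A R p q \<longleftrightarrow> p \<noteq> q \<and> (A ! fst p) (snd p) = (A ! fst q) (snd q) \<and> R p q"

definition negative_det :: "(real \<Rightarrow> complex) list \<Rightarrow> point \<Rightarrow> point \<Rightarrow> bool" where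
  "negative_det A p q \<longleftrightarrow>
     planar_det (vector_derivative (A ! fst p) (at (snd p)))
       (vector_derivative (A ! fst q) (at (snd q))) < 0"

text \<open>
  \<open>\<kappa> k\<close> says whether strand \<open>k\<close> belongs to component 1, and \<open>\<beta> k\<close> whether it is traversed backwards.
  Only the direction of the over strand enters, because reversing the under strand changes the
  sign of the crossing and also exchanges the two sides of the jump.
\<close>

definition local_coloring ::
  "(real \<Rightarrow> complex) list \<Rightarrow> (point \<Rightarrow> point \<Rightarrow> bool) \<Rightarrow> (nat \<Rightarrow> bool) \<Rightarrow> (nat \<Rightarrow> bool) \<Rightarrow>
   (point \<Rightarrow> color) \<Rightarrow> bool"
where
  "local_coloring A R \<kappa> \<beta> \<phi> \<longleftrightarrow>
     (\<forall>p \<in> strand_points A. (\<forall>q \<in> strand_points A. \<not> crosses A R q p) \<longrightarrow>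
        (\<forall>\<^sub>F s in at (snd p) within {-1..1}. \<phi> (fst p, s) = \<phi> p)) \<and>
     (\<forall>p \<in> strand_points A. \<forall>q \<in> strand_points A. crosses A R q p \<longrightarrow>
        jump (\<lambda>s. \<phi> (fst p, s)) (snd p) (\<kappa> (fst p) \<noteq> \<kappa> (fst q))
          (negative_det A q p \<noteq> \<beta> (fst q)) (\<phi> q))"

text \<open>The first condition lets membership in the strands be tested by position in the plane.
  The second keeps double points away from the ends of strands, where the local coloring is to be
  glued to the rest.\<close>

definition tame :: "(real \<Rightarrow> complex) list \<Rightarrow> bool" where
  "tame A \<longleftrightarrow> (\<forall>p \<in> strand_points A. (A ! fst p) (snd p) \<in> square) \<and>
     (\<forall>p \<in> strand_points A. \<forall>q \<in> strand_points A.
        p \<noteq> q \<longrightarrow> (A ! fst p) (snd p) = (A ! fst q) (snd q) \<longrightarrow> \<bar>snd p\<bar> < 1)"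

lemma same_point_sym: "same_point x y \<Longrightarrow> same_point y x"
  using Ints_minus[of "snd x - snd y"] by (simp add: same_point_def)

lemma same_point_trans: "same_point x y \<Longrightarrow> same_point y z \<Longrightarrow> same_point x z"
  using Ints_add[of "snd x - snd y" "snd y - snd z"] by (simp add: same_point_def)

lemma same_point_refl: "same_point x x"
  by (simp add: same_point_def)

lemma same_point_source: "same_point x y \<Longrightarrow> y \<in> source m \<Longrightarrow> x \<in> source m"
  by (auto simp: same_point_def source_def mem_Times_iff)

lemma at_point_same_point:
  assumes "virtual_diagram m D" "x \<in> source m" "same_point x y"
  shows "at_point D x = at_point D y"
proof -
  have per: "curve D (fst x) (t + 1) = curve D (fst x) t + 0" for t
    using virtual_diagramD(1)[OF assms(1), of "fst x"] assms(2)
    by (simp add: closed_immersion_def source_def mem_Times_iff)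
  obtain n where "snd x - snd y = of_int n" using assms(3) by (auto simp: same_point_def elim: Ints_cases)
  then have x: "snd x = snd y + of_int n" by simp
  show ?thesis
    unfolding at_point_def x using int_shift[of "curve D (fst x)" 0 "snd y" n] per assms(3)
    by (simp add: same_point_def)
qed

text \<open>Closedness yields neighborhoods free of unwanted strands. \<open>J\<close> is
  \<open>\<int>\<close> for a whole strand, and \<open>\<int>\<close> without one element when a
  strand is to be separated from its own other translates.\<close>

lemma closed_shifted_interval:
  assumes "J \<subseteq> \<int>"
  shows "closed {t :: real. \<exists>s \<in> {-1..1}. \<exists>j \<in> J. t = \<alpha> + \<beta> * s + j}"
proof -
  have "compact ((\<lambda>s. \<alpha> + \<beta> * s) ` {-1..1})"
    by (intro compact_continuous_image continuous_intros) auto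
  moreover have "closed J" using assms by (rule closed_subset_Ints)
  ultimately have "closed (\<Union>x \<in> (\<lambda>s. \<alpha> + \<beta> * s) ` {-1..1}. \<Union>y \<in> J. {x + y})"
    by (rule compact_closed_sums)
  moreover have "(\<Union>x \<in> (\<lambda>s. \<alpha> + \<beta> * s) ` {-1..1}. \<Union>y \<in> J. {x + y}) =
      {t. \<exists>s \<in> {-1..1}. \<exists>j \<in> J. t = \<alpha> + \<beta> * s + j}" by auto
  ultimately show ?thesis by simp
qed

lemma in_strands_length: "length A = length B \<Longrightarrow> in_strands A e x = in_strands B e x"
  by (simp add: in_strands_def strand_points_def)

text \<open>One side of a local move; both sides are instances with the same placement
  \<open>c\<close>, \<open>a\<close>, \<open>b\<close>.\<close>

locale placed_tangle =
  fixes m :: nat and D :: diagram and c :: "nat \<Rightarrow> nat" and a b :: "nat \<Rightarrow> real"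
    and A :: "(real \<Rightarrow> complex) list" and R :: "point \<Rightarrow> point \<Rightarrow> bool"
  assumes virtual: "virtual_diagram m D"
    and nonzero: "k < length A \<Longrightarrow> b k \<noteq> 0"
    and meets: "meets_square_in m D (place c a b) A R"
    and tame: "tame A"
begin

abbreviation "pl \<equiv> place c a b"

lemma strand_source: "p \<in> strand_points A \<Longrightarrow> pl p \<in> source m"
  using meets by (simp add: meets_square_in_def)

lemma strand_unique:
  assumes "p \<in> strand_points A" "q \<in> strand_points A" "same_point x (pl p)" "same_point x (pl q)"
  shows "p = q"
proof -
  have "same_point (pl p) (pl q)"
    by (rule same_point_trans[OF same_point_sym[OF assms(3)] assms(4)])
  then show ?thesis using meets assms(1,2) unfolding meets_square_in_def by blast
qed

lemma at_point_strand:
  assumes "p \<in> strand_points A" "same_point x (pl p)"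
  shows "at_point D x = (A ! fst p) (snd p)"
  using at_point_same_point[OF virtual same_point_source[OF assms(2) strand_source[OF assms(1)]] assms(2)]
    meets assms(1) by (simp add: meets_square_in_def)

lemma in_strands_iff_square:
  assumes "x \<in> source m"
  shows "in_strands A pl x \<longleftrightarrow> at_point D x \<in> square"
proof
  assume "in_strands A pl x"
  then obtain p where p: "p \<in> strand_points A" "same_point x (pl p)" by (auto simp: in_strands_def)
  then show "at_point D x \<in> square" using tame at_point_strand[OF p] by (simp add: tame_def)
next
  assume "at_point D x \<in> square"
  then show "in_strands A pl x" using meets assms by (simp add: meets_square_in_def)
qed

text \<open>Both preimages of a crossing have the same image, and the image alone decides whether a
  point belongs to the strands. Hence no crossing is partly inside and partly outside.\<close>

lemma over_in_strands:
  assumes "x \<in> source m" "y \<in> source m" "over D y x"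
  shows "in_strands A pl x \<longleftrightarrow> in_strands A pl y"
  using in_strands_iff_square assms virtual_diagramD(2)[OF virtual assms(2,1,3)] by metis

lemma over_iff_crosses:
  assumes "p \<in> strand_points A" "q \<in> strand_points A" "same_point x (pl p)" "same_point y (pl q)"
  shows "over D y x \<longleftrightarrow> crosses A R q p"
proof -
  have "over D y x \<longleftrightarrow> over D (pl q) (pl p)"
    using virtual_diagramD(4)[OF virtual _ _ _ _ assms(4,3)] assms same_point_source strand_source by blast
  also have "\<dots> \<longleftrightarrow> crosses A R q p"
    using meets assms unfolding meets_square_in_def crosses_def by blast
  finally show ?thesis .
qed

lemma same_point_strand:
  assumes "same_point x (pl p)" "b (fst p) \<noteq> 0"
  shows "same_point (fst x, t) (pl (fst p, snd p + (t - snd x) / b (fst p)))"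
proof -
  have "b (fst p) * (snd p + (t - snd x) / b (fst p)) = b (fst p) * snd p + (t - snd x)"
    using assms(2) by (simp add: field_simps)
  then have eq: "t - (a (fst p) + b (fst p) * (snd p + (t - snd x) / b (fst p))) =
      snd x - (a (fst p) + b (fst p) * snd p)" by linarith
  show ?thesis using assms(1) by (simp only: same_point_def place_def split_beta fst_conv snd_conv eq)
qed

lemma eventually_in_strand:
  assumes "p \<in> strand_points A" "same_point x (pl p)" "\<bar>snd p\<bar> < 1"
  shows "\<forall>\<^sub>F t in nhds (snd x). (fst p, snd p + (t - snd x) / b (fst p)) \<in> strand_points A \<and>
    \<bar>snd p + (t - snd x) / b (fst p)\<bar> < 1"
proof -
  have "((\<lambda>t. \<bar>snd p + (t - snd x) / b (fst p)\<bar>) \<longlongrightarrow> \<bar>snd p + (snd x - snd x) / b (fst p)\<bar>) (nhds (snd x))"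
    using nonzero assms(1)
    by (intro tendsto_intros filterlim_ident) (auto simp: strand_points_def)
  then have "\<forall>\<^sub>F t in nhds (snd x). \<bar>snd p + (t - snd x) / b (fst p)\<bar> < 1"
    using assms(3) by (intro order_tendstoD(2)) auto
  then show ?thesis
    by eventually_elim (use assms(1) in \<open>auto simp: strand_points_def abs_less_iff\<close>)
qed

text \<open>The other strands on the same component, together with the other integer translates of
  the strand of \<open>p\<close>, form a closed set (\<open>bad\<close>) that misses
  \<open>snd x\<close>. This also holds at the ends of the strand.\<close>

lemma eventually_strand_unique:
  assumes "p \<in> strand_points A" "same_point x (pl p)"
  shows "\<forall>\<^sub>F t in nhds (snd x). \<forall>q \<in> strand_points A. same_point (fst x, t) (pl q) \<longrightarrow>
    q = (fst p, snd p + (t - snd x) / b (fst p))"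
proof -
  obtain k s where p: "p = (k, s)" by fastforce
  define W where "W k J = {t. \<exists>s \<in> {-1..1}. \<exists>j \<in> J. t = a k + b k * s + j}" for k J
  define j where "j = snd x - (a k + b k * s)"
  have c: "c k = fst x" and j: "j \<in> \<int>" and k: "k < length A" and s: "s \<in> {-1..1}"
    using assms by (auto simp: p same_point_def place_def j_def strand_points_def)
  define bad where "bad = (\<Union>l \<in> {l. l < length A \<and> c l = fst x \<and> l \<noteq> k}. W l \<int>) \<union> W k (\<int> - {j})"
  have "closed bad"
    unfolding bad_def W_def by (intro closed_Un closed_UN ballI closed_shifted_interval) auto
  moreover have "snd x \<notin> bad"
  proof
    assume "snd x \<in> bad"
    then consider (1) l where "l < length A" "c l = fst x" "l \<noteq> k" "snd x \<in> W l \<int>"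
      | (2) "snd x \<in> W k (\<int> - {j})" unfolding bad_def by blast
    then have "\<exists>l s' j'. l < length A \<and> c l = fst x \<and> s' \<in> {-1..1} \<and> j' \<in> \<int> \<and>
      snd x = a l + b l * s' + j' \<and> (l \<noteq> k \<or> j' \<noteq> j)"
    proof cases
      case 1
      then show ?thesis unfolding W_def by blast
    next
      case 2
      then show ?thesis using k c unfolding W_def by blast
    qed
    then obtain l s' j' where l: "l < length A" "c l = fst x" "s' \<in> {-1..1}" "j' \<in> \<int>"
      and e: "snd x = a l + b l * s' + j'" and n: "l \<noteq> k \<or> j' \<noteq> j"
      by blast
    have "same_point x (pl (l, s'))" using l e by (simp add: same_point_def place_def)
    moreover have "(l, s') \<in> strand_points A" using l by (simp add: strand_points_def)
    ultimately have "(l, s') = (k, s)"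
      using strand_unique[OF _ assms(1) _ assms(2)] p by blast
    then show False using n e by (simp add: j_def)
  qed
  ultimately have "\<forall>\<^sub>F t in nhds (snd x). t \<in> - bad"
    by (intro eventually_nhds_in_open) auto
  then show ?thesis
  proof eventually_elim
    fix t assume t: "t \<in> - bad"
    show "\<forall>q \<in> strand_points A. same_point (fst x, t) (pl q) \<longrightarrow>
      q = (fst p, snd p + (t - snd x) / b (fst p))"
    proof (intro ballI impI)
      fix q assume "q \<in> strand_points A" and q: "same_point (fst x, t) (pl q)"
      then obtain l s' where l: "q = (l, s')" "l < length A" "s' \<in> {-1..1}"
        by (auto simp: strand_points_def)
      define j' where "j' = t - (a l + b l * s')"
      have e: "t = a l + b l * s' + j'" by (simp add: j'_def)
      have j': "c l = fst x" "j' \<in> \<int>" using q by (auto simp: l same_point_def place_def j'_def)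
      have "l = k"
      proof (rule ccontr)
        assume "l \<noteq> k"
        then have "t \<in> bad" using e j' l by (force simp: bad_def W_def)
        then show False using t by simp
      qed
      moreover have "j' = j"
      proof (rule ccontr)
        assume "j' \<noteq> j"
        then have "t \<in> bad" using e j' l \<open>l = k\<close> by (force simp: bad_def W_def)
        then show False using t by simp
      qed
      ultimately have "t - snd x = b k * (s' - s)" using e by (simp add: j_def algebra_simps)
      then show "q = (fst p, snd p + (t - snd x) / b (fst p))"
        using nonzero[OF k] \<open>l = k\<close> l by (simp add: p)
    qed
  qed
qed

lemma eventually_outside:
  assumes "\<not> in_strands A pl x"
  shows "\<forall>\<^sub>F t in nhds (snd x). \<not> in_strands A pl (fst x, t)"
proof -
  define W where "W = (\<Union>k \<in> {k. k < length A \<and> c k = fst x}.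
    {t. \<exists>s \<in> {-1..1}. \<exists>j \<in> \<int>. t = a k + b k * s + j})"
  have W: "in_strands A pl (fst x, t) \<longleftrightarrow> t \<in> W" for t
  proof -
    have int: "t - r \<in> \<int> \<longleftrightarrow> (\<exists>j \<in> \<int>. t = r + j)" for r
      by (auto intro: bexI[of _ "t - r"])
    have "in_strands A pl (fst x, t) \<longleftrightarrow>
        (\<exists>k < length A. \<exists>s \<in> {-1..1}. fst x = c k \<and> t - (a k + b k * s) \<in> \<int>)"
      by (simp add: in_strands_def strand_points_def same_point_def place_def Bex_def conj_ac) blast
    also have "\<dots> \<longleftrightarrow> t \<in> W"
      unfolding int W_def UN_iff mem_Collect_eq bex_simps Bex_def by metis
    finally show ?thesis .
  qed
  have "closed W" unfolding W_def by (intro closed_UN ballI closed_shifted_interval) auto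
  moreover have "snd x \<notin> W" using assms W[of "snd x"] by simp
  ultimately have "\<forall>\<^sub>F t in nhds (snd x). t \<in> - W" by (intro eventually_nhds_in_open) auto
  then show ?thesis by eventually_elim (simp add: W)
qed

text \<open>The function \<open>A ! k\<close> agrees with the curve of the diagram only on
  \<open>{-1..1}\<close>, so two-sided derivatives can be compared only in the interior.\<close>

lemma strand_velocity:
  assumes "p \<in> strand_points A" "same_point x (pl p)" "\<bar>snd p\<bar> < 1"
  shows "vector_derivative (A ! fst p) (at (snd p)) = b (fst p) *\<^sub>R velocity D x"
proof -
  have x: "x \<in> source m" by (rule same_point_source[OF assms(2) strand_source[OF assms(1)]])
  have b: "b (fst p) \<noteq> 0" using nonzero assms(1) by (auto simp: strand_points_def)
  define g where "g s = snd x + b (fst p) * (s - snd p)" for s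
  have "(g has_vector_derivative b (fst p)) (at (snd p))"
    unfolding g_def by (auto intro!: derivative_eq_intros simp: has_real_derivative_iff_has_vector_derivative[symmetric])
  moreover have "(curve D (fst x) has_vector_derivative velocity D x) (at (g (snd p)))"
    using curve_has_vector_derivative[OF virtual x] by (simp add: g_def)
  ultimately have v: "(curve D (fst x) \<circ> g has_vector_derivative b (fst p) *\<^sub>R velocity D x) (at (snd p))"
    by (rule vector_diff_chain_at)
  have eq: "(curve D (fst x) \<circ> g) s = (A ! fst p) s" if "s \<in> {-1<..<1}" for s
  proof -
    have "same_point (fst x, g s) (pl (fst p, s))"
      using same_point_strand[OF assms(2) b, of "g s"] b by (simp add: g_def)
    then have "at_point D (fst x, g s) = (A ! fst p) s"
      using at_point_strand[of "(fst p, s)"] assms(1) that by (auto simp: strand_points_def)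
    then show ?thesis by (simp add: at_point_def)
  qed
  have "(A ! fst p has_vector_derivative b (fst p) *\<^sub>R velocity D x) (at (snd p))"
    by (rule has_vector_derivative_transform_within_open[OF v open_greaterThanLessThan _ eq])
      (use assms(3) in auto)
  then show ?thesis by (rule vector_derivative_at)
qed

lemma crosses_inside:
  assumes "p \<in> strand_points A" "q \<in> strand_points A" "crosses A R q p"
  shows "\<bar>snd p\<bar> < 1" "\<bar>snd q\<bar> < 1"
proof -
  have ends: "\<bar>snd p\<bar> < 1"
    if "p \<in> strand_points A" "q \<in> strand_points A" "p \<noteq> q" "(A ! fst p) (snd p) = (A ! fst q) (snd q)"
    for p q using tame that unfolding tame_def by blast
  show "\<bar>snd p\<bar> < 1" "\<bar>snd q\<bar> < 1"
    using ends[of p q] ends[of q p] assms by (auto simp: crosses_def)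
qed

lemma negative_det_strands:
  assumes "p \<in> strand_points A" "q \<in> strand_points A" "same_point x (pl p)" "same_point y (pl q)"
    "crosses A R q p"
  shows "negative_det A q p \<longleftrightarrow>
    (planar_det (velocity D y) (velocity D x) < 0) \<noteq> ((b (fst q) < 0) \<noteq> (b (fst p) < 0))"
proof -
  have xy: "x \<in> source m" "y \<in> source m"
    using assms same_point_source strand_source by blast+
  have "planar_det (velocity D y) (velocity D x) \<noteq> 0"
    using virtual_diagramD(3)[OF virtual xy(2,1)] over_iff_crosses[OF assms(1-4)] assms(5) by simp
  moreover have "b (fst p) \<noteq> 0" "b (fst q) \<noteq> 0"
    using nonzero assms(1,2) by (auto simp: strand_points_def)
  ultimately show ?thesis
    using strand_velocity[OF assms(1,3)] strand_velocity[OF assms(2,4)] crosses_inside[OF assms(1,2,5)]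
    by (auto simp: negative_det_def planar_det_scaleR mult_less_0_iff zero_less_mult_iff not_less
        order_le_less)
qed

lemma local_coloring_restrict:
  assumes "coloring m D f"
  shows "local_coloring A R (\<lambda>k. c k = 1) (\<lambda>k. b k < 0) (\<lambda>p. f (pl p))"
  unfolding local_coloring_def
proof (intro conjI ballI impI)
  fix p assume p: "p \<in> strand_points A" and nc: "\<forall>q \<in> strand_points A. \<not> crosses A R q p"
  obtain k s where ks: "p = (k, s)" by fastforce
  have b: "b k \<noteq> 0" using nonzero p by (auto simp: ks strand_points_def)
  have "\<not> over D y (pl p)" if y: "y \<in> source m" for y
  proof
    assume o: "over D y (pl p)"
    moreover have "in_strands A pl (pl p)"
      unfolding in_strands_def using p same_point_refl by blast
    ultimately have "in_strands A pl y"
      using over_in_strands[OF strand_source[OF p] y] by blast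
    then obtain q where "q \<in> strand_points A" "same_point y (pl q)" by (auto simp: in_strands_def)
    then show False using over_iff_crosses[OF p _ same_point_refl] nc o by blast
  qed
  then have "\<forall>\<^sub>F t in at (a k + b k * s). f (c k, t) = f (c k, a k + b k * s)"
    using coloringD(2)[OF assms strand_source[OF p]] by (simp add: ks place_def)
  moreover have "filterlim (\<lambda>s. a k + b k * s) (at (a k + b k * s)) (at s within {-1..1})"
    unfolding filterlim_at using b
    by (auto intro!: tendsto_intros simp: eventually_at_filter)
  ultimately have "\<forall>\<^sub>F s' in at s within {-1..1}. f (c k, a k + b k * s') = f (c k, a k + b k * s)"
    by (rule eventually_compose_filterlim)
  then show "\<forall>\<^sub>F s in at (snd p) within {-1..1}. f (pl (fst p, s)) = f (pl p)"
    by (simp add: ks place_def)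
next
  fix p q assume p: "p \<in> strand_points A" and q: "q \<in> strand_points A" and cr: "crosses A R q p"
  obtain k s where ks: "p = (k, s)" by fastforce
  have b: "b k \<noteq> 0" using nonzero p by (auto simp: ks strand_points_def)
  note refl = same_point_refl[of "pl p"] same_point_refl[of "pl q"]
  have "over D (pl q) (pl p)" using over_iff_crosses[OF p q refl] cr by simp
  then have "jump (\<lambda>t. f (c k, t)) (a k + b k * s) ((c k = 1) \<noteq> (c (fst q) = 1))
        (planar_det (velocity D (pl q)) (velocity D (pl p)) < 0) (f (pl q))"
    using coloringD(3)[OF assms strand_source[OF p] strand_source[OF q]]
    by (simp add: ks place_def split_beta)
  note j = jump_affine[OF b this]
  have d: "((planar_det (velocity D (pl q)) (velocity D (pl p)) < 0) \<noteq> (b k < 0)) \<longleftrightarrow>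
      (negative_det A q p \<noteq> (b (fst q) < 0))"
    using negative_det_strands[OF p q refl cr] by (simp add: ks) argo
  from j show "jump (\<lambda>s. f (pl (fst p, s))) (snd p) ((c (fst p) = 1) \<noteq> (c (fst q) = 1))
     (negative_det A q p \<noteq> (b (fst q) < 0)) (f (pl q))"
    unfolding d by (simp add: ks place_def split_beta)
qed

end

section \<open>Replacing a local coloring inside a diagram\<close>

lemma velocity_cong:
  assumes "\<forall>\<^sub>F t in nhds (snd x). at_point D' (fst x, t) = at_point D (fst x, t)"
  shows "velocity D' x = velocity D x"
  unfolding velocity_def
  by (rule vector_derivative_cong_eq) (use assms in \<open>auto simp: at_point_def\<close>)

text \<open>The new coloring is the old one outside the strands and \<open>\<phi>'\<close> on them.
  Agreement of \<open>\<phi>'\<close> with the old colors at both ends of every strand is what makes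
  the result locally constant where the two pieces meet.\<close>

theorem coloring_local_move:
  assumes move: "local_move m A B R D D'"
    and virtual: "virtual_diagram m D" "virtual_diagram m D'"
    and len: "length A = length B" and tame: "tame A" "tame B"
    and extend: "\<And>\<kappa> \<beta> \<phi>. local_coloring A R \<kappa> \<beta> \<phi> \<Longrightarrow>
      \<exists>\<phi>'. local_coloring B R \<kappa> \<beta> \<phi>' \<and> (\<forall>k < length A. \<phi>' (k, -1) = \<phi> (k, -1) \<and> \<phi>' (k, 1) = \<phi> (k, 1))"
    and f: "coloring m D f"
  shows "\<exists>f'. coloring m D' f'"
proof -
  obtain c a b where nz: "\<forall>k < length A. b k \<noteq> 0"
    and meets: "meets_square_in m D (place c a b) A R" "meets_square_in m D' (place c a b) B R"
    and same: "\<forall>x \<in> source m. \<not> in_strands A (place c a b) x \<longrightarrow> at_point D' x = at_point D x"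
    and same_over: "\<forall>x \<in> source m. \<forall>y \<in> source m.
        \<not> in_strands A (place c a b) x \<longrightarrow> \<not> in_strands A (place c a b) y \<longrightarrow>
        (over D' x y \<longleftrightarrow> over D x y)"
    using move unfolding local_move_def by (elim exE conjE)
  interpret D: placed_tangle m D c a b A R
    by standard (use virtual nz meets tame in auto)
  interpret D': placed_tangle m D' c a b B R
    by standard (use virtual nz meets tame len in auto)
  define pl where "pl = place c a b"
  define inside where "inside = in_strands A pl"
  have inside': "in_strands B pl = inside"
    unfolding inside_def using in_strands_length[OF len] by blast
  have SP: "strand_points B = strand_points A" by (simp add: strand_points_def len)
  obtain \<phi>' where \<phi>': "local_coloring B R (\<lambda>k. c k = 1) (\<lambda>k. b k < 0) \<phi>'"
    and ends: "\<forall>k < length A. \<phi>' (k, -1) = f (pl (k, -1)) \<and> \<phi>' (k, 1) = f (pl (k, 1))"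
    using extend[OF D.local_coloring_restrict[OF f]] by (auto simp: pl_def)
  \<comment> \<open>The choice is unique by \<open>strand_unique\<close>, which gives
    \<open>f'_in\<close>.\<close>
  define f' where "f' x = (if inside x then \<phi>' (SOME p. p \<in> strand_points A \<and> same_point x (pl p)) else f x)" for x
  have f'_in: "f' x = \<phi>' p" if "p \<in> strand_points A" "same_point x (pl p)" for x p
  proof -
    have "(SOME p. p \<in> strand_points A \<and> same_point x (pl p)) = p"
    proof (rule some_equality)
      show "p \<in> strand_points A \<and> same_point x (pl p)" using that by simp
      show "q = p" if "q \<in> strand_points A \<and> same_point x (pl q)" for q
        using D.strand_unique[of q p x] that \<open>p \<in> strand_points A\<close> \<open>same_point x (pl p)\<close>
        by (simp add: pl_def)
    qed
    moreover have "inside x" using that by (auto simp: inside_def in_strands_def)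
    ultimately show ?thesis by (simp add: f'_def)
  qed
  have f'_out: "f' x = f x" if "\<not> inside x" for x
    using that by (simp add: f'_def)
  have inside_cong: "inside x \<longleftrightarrow> inside y" if "same_point x y" for x y
    using that same_point_sym same_point_trans unfolding inside_def in_strands_def by blast
  have outside: "\<forall>\<^sub>F t in nhds (snd x). \<not> inside (fst x, t)" if "\<not> inside x" for x
    using D.eventually_outside that by (simp add: inside_def pl_def)
  have over_outside: "over D' y x \<longleftrightarrow> over D y x" if "x \<in> source m" "y \<in> source m" "\<not> inside x" for x y
    using same_over D.over_in_strands[OF that(1,2)] D'.over_in_strands[OF that(1,2)] that
    unfolding inside'[unfolded pl_def] by (auto simp: inside_def pl_def)
  have velocity_outside: "velocity D' x = velocity D x" if "x \<in> source m" "\<not> inside x" for x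
  proof (rule velocity_cong)
    show "\<forall>\<^sub>F t in nhds (snd x). at_point D' (fst x, t) = at_point D (fst x, t)"
      using outside[OF that(2)]
      by eventually_elim (use same that in \<open>auto simp: inside_def pl_def source_def mem_Times_iff\<close>)
  qed
  have "coloring m D' f'"
    unfolding coloring_def
  proof (intro conjI ballI impI)
    fix x y assume "x \<in> source m" "y \<in> source m" and s: "same_point x y"
    show "f' x = f' y"
    proof (cases "inside x")
      case True
      then obtain p where p: "p \<in> strand_points A" "same_point x (pl p)"
        by (auto simp: inside_def in_strands_def)
      then have "same_point y (pl p)" using s same_point_sym same_point_trans by blast
      then show ?thesis using f'_in p by metis
    next
      case False
      then show ?thesis
        using f'_out inside_cong[OF s] coloringD(1)[OF f \<open>x \<in> source m\<close> \<open>y \<in> source m\<close> s] by simp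
    qed
  next
    fix x assume x: "x \<in> source m" and nu: "\<forall>y \<in> source m. \<not> over D' y x"
    show "\<forall>\<^sub>F t in at (snd x). f' (fst x, t) = f' x"
    proof (cases "inside x")
      case False
      have "\<forall>\<^sub>F t in at (snd x). f (fst x, t) = f x"
        using coloringD(2)[OF f x] nu over_outside[OF x _ False] by blast
      moreover have "\<forall>\<^sub>F t in at (snd x). \<not> inside (fst x, t)"
        using outside[OF False] by (auto simp: eventually_nhds_conv_at)
      ultimately show ?thesis
        by eventually_elim (simp add: f'_out False)
    next
      case True
      then obtain p where p: "p \<in> strand_points A" and xp: "same_point x (pl p)"
        by (auto simp: inside_def in_strands_def)
      have b: "b (fst p) \<noteq> 0" using nz p by (auto simp: strand_points_def)
      define g where "g t = snd p + (t - snd x) / b (fst p)" for t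
      have nc: "\<not> crosses B R q p" if q: "q \<in> strand_points A" for q
        using nu D'.over_iff_crosses[of p q x "pl q"] D'.strand_source[of q] p q xp
        by (auto simp: SP pl_def same_point_refl)
      have "\<forall>\<^sub>F s in at (snd p) within {-1..1}. \<phi>' (fst p, s) = \<phi>' p"
        using \<phi>' p nc by (simp add: local_coloring_def SP)
      then have "\<forall>\<^sub>F s in at (snd p). s \<in> {-1..1} \<longrightarrow> \<phi>' (fst p, s) = \<phi>' p"
        by (simp add: eventually_at_filter imp_conjL)
      moreover have "filterlim g (at (snd p)) (at (snd x))"
        unfolding filterlim_at g_def using b
        by (auto intro!: tendsto_eq_intros simp: eventually_at_filter)
      ultimately have const: "\<forall>\<^sub>F t in at (snd x). g t \<in> {-1..1} \<longrightarrow> \<phi>' (fst p, g t) = \<phi>' p"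
        by (rule eventually_compose_filterlim)
      have only: "\<forall>\<^sub>F t in at (snd x). \<forall>q \<in> strand_points A. same_point (fst x, t) (pl q) \<longrightarrow> q = (fst p, g t)"
        using D.eventually_strand_unique[OF p] xp
        by (auto simp: eventually_nhds_conv_at pl_def g_def)
      \<comment> \<open>Parameters outside the strands occur near \<open>x\<close> only if
        \<open>p\<close> is an end of its strand. There tameness of \<open>A\<close> excludes an
        undercrossing of \<open>D\<close>, so \<open>f\<close> is locally constant, and
        \<open>ends\<close> identifies its value with that of \<open>\<phi>'\<close>.\<close>
      have out: "\<forall>\<^sub>F t in at (snd x). \<not> inside (fst x, t) \<longrightarrow> f (fst x, t) = f' x"
      proof (cases "\<bar>snd p\<bar> < 1")
        case True
        have "\<forall>\<^sub>F t in at (snd x). (fst p, g t) \<in> strand_points A"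
          using D.eventually_in_strand[OF p xp[unfolded pl_def] True]
          by (auto simp: eventually_nhds_conv_at g_def elim: eventually_mono)
        then show ?thesis
        proof eventually_elim
          fix t assume t: "(fst p, g t) \<in> strand_points A"
          have "same_point (fst x, t) (pl (fst p, g t))"
            using D.same_point_strand[OF xp[unfolded pl_def] b] by (simp add: pl_def g_def)
          then show "\<not> inside (fst x, t) \<longrightarrow> f (fst x, t) = f' x"
            using t by (auto simp: inside_def in_strands_def)
        qed
      next
        case False
        have "\<not> over D y x" if y: "y \<in> source m" for y
        proof
          assume o: "over D y x"
          then have "inside y" using D.over_in_strands[OF x y] True by (simp add: inside_def pl_def)
          then obtain q where q: "q \<in> strand_points A" "same_point y (pl q)"
            by (auto simp: inside_def in_strands_def)
          then have "crosses A R q p"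
            using D.over_iff_crosses[OF p q(1)] xp o by (auto simp: pl_def)
          then show False using D.crosses_inside[OF p q(1)] False by simp
        qed
        then have "\<forall>\<^sub>F t in at (snd x). f (fst x, t) = f x" using coloringD(2)[OF f x] by blast
        moreover have "f x = f' x"
        proof -
          have "snd p = -1 \<or> snd p = 1" using False p by (auto simp: strand_points_def)
          then have "\<phi>' p = f (pl p)" using ends p by (cases p) (auto simp: strand_points_def)
          then show ?thesis
            using f'_in[OF p xp] coloringD(1)[OF f x D.strand_source[OF p]] xp by (simp add: pl_def)
        qed
        ultimately show ?thesis by (auto elim: eventually_mono)
      qed
      show ?thesis using const only out
      proof eventually_elim
        fix t assume t: "g t \<in> {-1..1} \<longrightarrow> \<phi>' (fst p, g t) = \<phi>' p"
          "\<forall>q \<in> strand_points A. same_point (fst x, t) (pl q) \<longrightarrow> q = (fst p, g t)"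
          "\<not> inside (fst x, t) \<longrightarrow> f (fst x, t) = f' x"
        show "f' (fst x, t) = f' x"
        proof (cases "inside (fst x, t)")
          case True
          then obtain q where q: "q \<in> strand_points A" "same_point (fst x, t) (pl q)"
            by (auto simp: inside_def in_strands_def)
          then have "q = (fst p, g t)" using t(2) by blast
          then show ?thesis using t(1) q f'_in p xp by (auto simp: strand_points_def)
        next
          case False
          then show ?thesis using t(3) f'_out by simp
        qed
      qed
    qed
  next
    fix x y assume x: "x \<in> source m" and y: "y \<in> source m" and o: "over D' y x"
    show "jump (\<lambda>t. f' (fst x, t)) (snd x) ((fst x = 1) \<noteq> (fst y = 1))
          (planar_det (velocity D' y) (velocity D' x) < 0) (f' y)"
    proof (cases "inside x")
      case False
      have ny: "\<not> inside y"
        using D'.over_in_strands[OF x y o] False by (simp add: inside'[unfolded pl_def])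
      have "\<forall>\<^sub>F t in at (snd x). f (fst x, t) = f' (fst x, t)"
        using outside[OF False] by (auto simp: eventually_nhds_conv_at f'_out elim: eventually_mono)
      from jump_cong[OF this] show ?thesis
        using coloringD(3)[OF f x y] over_outside[OF x y False] o
          velocity_outside[OF x False] velocity_outside[OF y ny] f'_out[OF ny] by simp
    next
      case True
      then obtain p where p: "p \<in> strand_points A" and xp: "same_point x (pl p)"
        by (auto simp: inside_def in_strands_def)
      have "inside y" using D'.over_in_strands[OF x y o] True by (simp add: inside'[unfolded pl_def])
      then obtain q where q: "q \<in> strand_points A" and yq: "same_point y (pl q)"
        by (auto simp: inside_def in_strands_def)
      have b: "b (fst p) \<noteq> 0" using nz p by (auto simp: strand_points_def)
      have cr: "crosses B R q p"
        using D'.over_iff_crosses[of p q x y] p q xp yq o by (simp add: SP pl_def)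
      have abs: "\<bar>snd p\<bar> < 1" using D'.crosses_inside(1) p q cr by (simp add: SP)
      have "jump (\<lambda>s. \<phi>' (fst p, s)) (snd p) ((c (fst p) = 1) \<noteq> (c (fst q) = 1))
          (negative_det B q p \<noteq> (b (fst q) < 0)) (\<phi>' q)"
        using \<phi>' p q cr unfolding local_coloring_def SP by blast
      \<comment> \<open>Return from the parameter of the strand to that of the component. The sign
        of \<open>b (fst p)\<close> enters through this change of parameter and again through
        \<open>negative_det\<close>, and cancels.\<close>
      then have "jump (\<lambda>t. \<phi>' (fst p, (snd p - snd x / b (fst p)) + (1 / b (fst p)) * t)) (snd x)
          ((c (fst p) = 1) \<noteq> (c (fst q) = 1))
          ((negative_det B q p \<noteq> (b (fst q) < 0)) \<noteq> (1 / b (fst p) < 0)) (\<phi>' q)"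
        using b by (intro jump_affine[of "1 / b (fst p)" "\<lambda>s. \<phi>' (fst p, s)"]) auto
      moreover have "(snd p - snd x / b (fst p)) + (1 / b (fst p)) * t = snd p + (t - snd x) / b (fst p)" for t
        by (simp add: diff_divide_distrib)
      moreover have "((negative_det B q p \<noteq> (b (fst q) < 0)) \<noteq> (1 / b (fst p) < 0)) \<longleftrightarrow>
          planar_det (velocity D' y) (velocity D' x) < 0"
        using D'.negative_det_strands[of p q x y] p q xp yq cr
        by (simp add: SP pl_def) argo
      moreover have "c (fst p) = fst x" "c (fst q) = fst y"
        using xp yq by (auto simp: same_point_def pl_def place_def split_beta)
      moreover have "\<phi>' q = f' y" using f'_in q yq by simp
      ultimately have *: "jump (\<lambda>t. \<phi>' (fst p, snd p + (t - snd x) / b (fst p))) (snd x)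
          ((fst x = 1) \<noteq> (fst y = 1)) (planar_det (velocity D' y) (velocity D' x) < 0) (f' y)"
        by (simp only:)
      have "\<forall>\<^sub>F t in nhds (snd x). \<phi>' (fst p, snd p + (t - snd x) / b (fst p)) = f' (fst x, t)"
        using D.eventually_in_strand[OF p xp[unfolded pl_def] abs]
      proof eventually_elim
        fix t assume "(fst p, snd p + (t - snd x) / b (fst p)) \<in> strand_points A \<and>
          \<bar>snd p + (t - snd x) / b (fst p)\<bar> < 1"
        moreover have "same_point (fst x, t) (pl (fst p, snd p + (t - snd x) / b (fst p)))"
          using D.same_point_strand[OF xp[unfolded pl_def] b] by (simp add: pl_def)
        ultimately show "\<phi>' (fst p, snd p + (t - snd x) / b (fst p)) = f' (fst x, t)"
          by (intro f'_in[symmetric]) auto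
      qed
      then have "\<forall>\<^sub>F t in at (snd x). \<phi>' (fst p, snd p + (t - snd x) / b (fst p)) = f' (fst x, t)"
        by (simp add: eventually_nhds_conv_at)
      from jump_cong[OF this] * show ?thesis by simp
    qed
  qed
  then show ?thesis by blast
qed

lemma local_move_sym:
  assumes "local_move m A B R D D'" "length A = length B"
  shows "local_move m B A R D' D"
proof -
  obtain c a b where "\<forall>k < length A. b k \<noteq> 0"
    and "meets_square_in m D (place c a b) A R" "meets_square_in m D' (place c a b) B R"
    and "\<forall>x \<in> source m. \<not> in_strands A (place c a b) x \<longrightarrow> at_point D' x = at_point D x"
    and "\<forall>x \<in> source m. \<forall>y \<in> source m.
        \<not> in_strands A (place c a b) x \<longrightarrow> \<not> in_strands A (place c a b) y \<longrightarrow>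
        (over D' x y \<longleftrightarrow> over D x y)"
    using assms(1) unfolding local_move_def by (elim exE conjE)
  then show ?thesis
    unfolding local_move_def in_strands_length[OF assms(2)] assms(2)
    by (intro exI[of _ c] exI[of _ a] exI[of _ b]) simp
qed

section \<open>Braids\<close>

text \<open>
  The two strands of a crossing of graphs have the same parameter. A crossing \<open>(s, i, j, d)\<close> has parameter \<open>s\<close>,
  over strand \<open>i\<close> and under strand \<open>j\<close>; \<open>d\<close> says that it is negative if both strands run from left to
  right.
\<close>

type_synonym crossing = "real \<times> nat \<times> nat \<times> bool"

definition pass :: "(nat \<Rightarrow> bool) \<Rightarrow> (nat \<Rightarrow> bool) \<Rightarrow> crossing \<Rightarrow> (nat \<Rightarrow> color) \<Rightarrow> nat \<Rightarrow> color" where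
  "pass \<kappa> \<beta> = (\<lambda>(s, i, j, d) \<sigma>. \<sigma>(j := act (\<kappa> j \<noteq> \<kappa> i) (d \<noteq> \<beta> i) (\<sigma> j) (\<sigma> i)))"

text \<open>The interval is variable because the inductions below split off the leftmost crossing
  together with the piece of the picture before it.\<close>

definition braid_coloring ::
  "crossing list \<Rightarrow> (nat \<Rightarrow> bool) \<Rightarrow> (nat \<Rightarrow> bool) \<Rightarrow> nat \<Rightarrow> real \<Rightarrow> real \<Rightarrow> (point \<Rightarrow> color) \<Rightarrow> bool"
where
  "braid_coloring E \<kappa> \<beta> n l r \<phi> \<longleftrightarrow>
     (\<forall>k < n. \<forall>s \<in> {l..r}. (\<forall>i d. (s, i, k, d) \<notin> set E) \<longrightarrow>
        (\<forall>\<^sub>F s' in at s within {l..r}. \<phi> (k, s') = \<phi> (k, s))) \<and>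
     (\<forall>(s, i, k, d) \<in> set E.
        jump (\<lambda>s'. \<phi> (k, s')) s (\<kappa> k \<noteq> \<kappa> i) (d \<noteq> \<beta> i) (\<phi> (i, s)))"

definition braid_word :: "nat \<Rightarrow> real \<Rightarrow> real \<Rightarrow> crossing list \<Rightarrow> bool" where
  "braid_word n l r E \<longleftrightarrow> sorted_wrt (\<lambda>e e'. fst e < fst e') E \<and>
     (\<forall>(s, i, j, d) \<in> set E. l < s \<and> s < r \<and> i < n \<and> j < n \<and> i \<noteq> j)"

lemma locally_constant_on_connected:
  assumes "connected S" "\<And>x. x \<in> S \<Longrightarrow> \<forall>\<^sub>F y in at x within S. g y = g x" "x \<in> S" "y \<in> S"
  shows "g x = g y"
  by (rule connected_local_const[OF assms(1,3,4)])
    (use assms(2) in \<open>auto elim!: eventually_mono simp: eq_commute\<close>)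

lemma braid_word_Cons:
  "braid_word n l r ((t, i, j, d) # E) \<longleftrightarrow>
    l < t \<and> t < r \<and> i < n \<and> j < n \<and> i \<noteq> j \<and> braid_word n t r E"
  unfolding braid_word_def by (fastforce)

lemma braid_word_time: "braid_word n l r E \<Longrightarrow> (s, i, j, d) \<in> set E \<Longrightarrow> l < s"
  by (auto simp: braid_word_def)

lemma eventually_within_subset:
  "eventually P (at x within S) \<Longrightarrow> T \<subseteq> S \<Longrightarrow> eventually P (at x within T)"
  by (rule filter_leD[OF at_le])

lemma eventually_at_greater: "t < s \<Longrightarrow> \<forall>\<^sub>F s' in at s within S. t < (s' :: real)"
  by (rule order_tendstoD(1)[OF tendsto_ident_at])

text \<open>To the right of \<open>t\<close> the two colorings agree and the two words list the same
  crossings, so the conditions transfer. This serves both removing the first crossing of a word and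
  prepending one.\<close>

lemma braid_coloring_glue:
  assumes \<phi>: "braid_coloring F \<kappa> \<beta> n l' r \<phi>" "l' \<le> t"
    and F: "\<And>s i k d. t < s \<Longrightarrow> (s, i, k, d) \<in> set F \<longleftrightarrow> (s, i, k, d) \<in> set E"
    and eq: "\<And>k s. t < s \<Longrightarrow> \<psi> (k, s) = \<phi> (k, s)"
    and s: "t < s" "s \<le> r"
  shows "k < n \<Longrightarrow> (\<And>i d. (s, i, k, d) \<notin> set E) \<Longrightarrow> \<forall>\<^sub>F s' in at s within S \<inter> {t..r}. \<psi> (k, s') = \<psi> (k, s)"
    and "(s, i', k, e) \<in> set E \<Longrightarrow>
      jump (\<lambda>s'. \<psi> (k, s')) s (\<kappa> k \<noteq> \<kappa> i') (e \<noteq> \<beta> i') (\<psi> (i', s))"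
proof -
  assume k: "k < n" and no: "\<And>i d. (s, i, k, d) \<notin> set E"
  have "\<forall>\<^sub>F s' in at s within {l'..r}. \<phi> (k, s') = \<phi> (k, s)"
    using \<phi> k no F[OF s(1)] s by (auto simp: braid_coloring_def)
  then have "\<forall>\<^sub>F s' in at s within S \<inter> {t..r}. \<phi> (k, s') = \<phi> (k, s)"
    by (rule eventually_within_subset) (use \<phi>(2) in auto)
  with eventually_at_greater[OF s(1)]
  show "\<forall>\<^sub>F s' in at s within S \<inter> {t..r}. \<psi> (k, s') = \<psi> (k, s)"
    by eventually_elim (simp add: eq s)
next
  assume "(s, i', k, e) \<in> set E"
  then have "(s, i', k, e) \<in> set F" using F[OF s(1)] by simp
  then have "jump (\<lambda>s'. \<phi> (k, s')) s (\<kappa> k \<noteq> \<kappa> i') (e \<noteq> \<beta> i') (\<phi> (i', s))"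
    using \<phi>(1) unfolding braid_coloring_def by fast
  moreover have "\<forall>\<^sub>F s' in at s. \<psi> (k, s') = \<phi> (k, s')"
    using eventually_at_greater[OF s(1)] by eventually_elim (simp add: eq)
  ultimately show "jump (\<lambda>s'. \<psi> (k, s')) s (\<kappa> k \<noteq> \<kappa> i') (e \<noteq> \<beta> i') (\<psi> (i', s))"
    using jump_cong eq[OF s(1)] by metis
qed

text \<open>The colors at the left end determine those at the right end: they are constant between
  crossings, and each crossing changes the color of its under strand as \<open>pass\<close>
  prescribes.\<close>

lemma braid_coloring_run:
  assumes "braid_coloring E \<kappa> \<beta> n l r \<phi>" "braid_word n l r E" "l \<le> r" "k < n"
  shows "\<phi> (k, r) = fold (pass \<kappa> \<beta>) E (\<lambda>k. \<phi> (k, l)) k"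
  using assms
proof (induction E arbitrary: l \<phi>)
  case Nil
  have "\<phi> (k, r) = \<phi> (k, l)"
    by (rule locally_constant_on_connected[of "{l..r}" "\<lambda>s. \<phi> (k, s)"])
      (use Nil in \<open>auto simp: braid_coloring_def\<close>)
  then show ?case by simp
next
  case (Cons e E)
  obtain t i j d where e: "e = (t, i, j, d)" by (metis prod_cases4)
  have w: "braid_word n l r ((t, i, j, d) # E)" using Cons.prems(2) by (simp add: e)
  have t: "l < t" "t < r" "i < n" "j < n" "i \<noteq> j" and w': "braid_word n t r E"
    using w by (auto simp: braid_word_Cons)
  have later: "t < s" if "(s, i', k', d') \<in> set E" for s i' k' d'
    using braid_word_time[OF w' that] .
  note \<phi> = Cons.prems(1)[unfolded e]
  define \<sigma> where "\<sigma> k = \<phi> (k, l)" for k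
  define \<sigma>' where "\<sigma>' = pass \<kappa> \<beta> (t, i, j, d) \<sigma>"
  have const: "\<forall>\<^sub>F s' in at s within {l..r}. \<phi> (k, s') = \<phi> (k, s)"
    if "k < n" "l \<le> s" "s < t \<or> s = t \<and> k \<noteq> j" for k s
  proof -
    have "(s, i', k, d') \<notin> set ((t, i, j, d) # E)" for i' d'
      using that later[of s i' k d'] by auto
    moreover have "s \<le> r" using that t by auto
    ultimately show ?thesis
      using \<phi>[unfolded braid_coloring_def, THEN conjunct1, rule_format, of k s] that t by simp
  qed
  have left: "\<phi> (k, s) = \<sigma> k" if "k < n" "l \<le> s" "s < t \<or> s = t \<and> k \<noteq> j" for k s
    unfolding \<sigma>_def
  proof (rule locally_constant_on_connected[of "{l..s}" "\<lambda>s. \<phi> (k, s)"])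
    fix x assume "x \<in> {l..s}"
    then show "\<forall>\<^sub>F y in at x within {l..s}. \<phi> (k, y) = \<phi> (k, x)"
      using that t by (intro eventually_within_subset[OF const]) auto
  qed (use that in auto)
  have "jump (\<lambda>s'. \<phi> (j, s')) t (\<kappa> j \<noteq> \<kappa> i) (d \<noteq> \<beta> i) (\<sigma> i)"
    using \<phi> left[of i t] t by (simp add: braid_coloring_def)
  then obtain u where u: "\<forall>\<^sub>F s in at_left t. \<phi> (j, s) = u"
    "\<forall>\<^sub>F s in at_right t. \<phi> (j, s) = act (\<kappa> j \<noteq> \<kappa> i) (d \<noteq> \<beta> i) u (\<sigma> i)"
    unfolding jump_def by blast
  have "\<forall>\<^sub>F s in at_left t. l < s \<and> s < t" using t(1) by (auto simp: eventually_at_left_field)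
  with u(1) have "\<forall>\<^sub>F s in at_left t. u = \<sigma> j"
    by eventually_elim (use left[of j] t in force)
  then have u_eq: "u = \<sigma> j" by simp
  have right: "\<forall>\<^sub>F s in at_right t. \<phi> (k, s) = \<sigma>' k" if "k < n" for k
  proof (cases "k = j")
    case True
    then show ?thesis using u(2) u_eq by (simp add: \<sigma>'_def pass_def)
  next
    case False
    have "\<forall>\<^sub>F s in at t within {t<..r}. \<phi> (k, s) = \<phi> (k, t)"
      using const[of k t] that t False by (intro eventually_within_subset[OF const]) auto
    moreover have "at t within {t<..r} = at_right t"
      using t(2) by (intro at_within_nhd[of _ "{..<r}"]) auto
    ultimately show ?thesis using left[of k t] that t False by (simp add: \<sigma>'_def pass_def)
  qed
  \<comment> \<open>The value of \<open>\<phi>\<close> on strand \<open>j\<close> at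
    \<open>t\<close> itself is arbitrary, so it is overwritten by the color just after the crossing;
    only then does the shorter word start with \<open>\<sigma>'\<close>.\<close>
  define \<psi> where "\<psi> = (\<lambda>(k, s). if s \<le> t then \<sigma>' k else \<phi> (k, s))"
  have \<psi>: "t < s \<Longrightarrow> \<psi> (k, s) = \<phi> (k, s)" for k s by (simp add: \<psi>_def)
  have F: "t < s \<Longrightarrow> (s, i', k', d') \<in> set ((t, i, j, d) # E) \<longleftrightarrow> (s, i', k', d') \<in> set E"
    for s i' k' d' by auto
  note glue = braid_coloring_glue[OF \<phi> less_imp_le[OF t(1)] F \<psi>]
  have "braid_coloring E \<kappa> \<beta> n t r \<psi>"
    unfolding braid_coloring_def
  proof (intro conjI allI impI ballI, goal_cases)
    case (1 k s)
    show ?case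
    proof (cases "s = t")
      case True
      have "\<forall>\<^sub>F s' in at_right t. \<psi> (k, s') = \<psi> (k, t)"
        using right[OF 1(1)] eventually_at_right_less[of t]
        by eventually_elim (simp add: \<psi>_def)
      moreover have "at t within {t..r} = at_right t"
        using t(2) by (intro at_within_nhd[of _ "{..<r}"]) auto
      ultimately show ?thesis using True by simp
    next
      case False
      then show ?thesis using glue(1)[of s k UNIV] 1 by simp
    qed
  next
    case (2 x)
    then obtain s i' k e' where x: "x = (s, i', k, e')" by (metis prod_cases4)
    moreover have "t < s" "s \<le> r" using 2 w' by (auto simp: x braid_word_def)
    ultimately show ?case using glue(2)[of s i' k e'] 2 by simp
  qed
  from Cons.IH[OF this w' less_imp_le[OF t(2)] Cons.prems(4)]
  have "\<phi> (k, r) = fold (pass \<kappa> \<beta>) E (\<lambda>k. \<psi> (k, t)) k" using t(2) by (simp add: \<psi>)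
  moreover have "(\<lambda>k. \<psi> (k, t)) = pass \<kappa> \<beta> e (\<lambda>k. \<phi> (k, l))"
    by (simp add: \<psi>_def \<sigma>'_def \<sigma>_def[abs_def] e)
  ultimately show ?case by simp
qed

lemma braid_coloring_exists:
  assumes "braid_word n l r E" "l \<le> r"
  shows "\<exists>\<phi>. braid_coloring E \<kappa> \<beta> n l r \<phi> \<and> (\<forall>k. \<phi> (k, l) = \<sigma> k)"
  using assms
proof (induction E arbitrary: l \<sigma>)
  case Nil
  then show ?case by (intro exI[of _ "\<lambda>(k, s). \<sigma> k"]) (simp add: braid_coloring_def)
next
  case (Cons e E)
  obtain t i j d where e: "e = (t, i, j, d)" by (metis prod_cases4)
  have w: "braid_word n l r ((t, i, j, d) # E)" using Cons.prems(1) by (simp add: e)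
  have t: "l < t" "t < r" "i < n" "j < n" "i \<noteq> j" and w': "braid_word n t r E"
    using w by (auto simp: braid_word_Cons)
  have later: "t < s" if "(s, i', k', d') \<in> set E" for s i' k' d'
    using braid_word_time[OF w' that] .
  define \<sigma>' where "\<sigma>' = pass \<kappa> \<beta> (t, i, j, d) \<sigma>"
  obtain \<phi> where \<phi>: "braid_coloring E \<kappa> \<beta> n t r \<phi>" and start: "\<And>k. \<phi> (k, t) = \<sigma>' k"
    using Cons.IH[OF w' less_imp_le[OF t(2)], of \<sigma>'] by blast
  \<comment> \<open>At \<open>t\<close> the colors before the crossing are taken. Strands other than
    \<open>j\<close> have the same color before and after, and the value on \<open>j\<close> is
    free.\<close>
  define \<psi> where "\<psi> = (\<lambda>(k, s). if s \<le> t then \<sigma> k else \<phi> (k, s))"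
  have \<psi>: "t < s \<Longrightarrow> \<psi> (k, s) = \<phi> (k, s)" for k s by (simp add: \<psi>_def)
  note glue = braid_coloring_glue[OF \<phi> order_refl refl \<psi>]
  have right: "\<forall>\<^sub>F s in at_right t. \<psi> (k, s) = \<sigma>' k" if "k < n" for k
  proof -
    have "\<forall>\<^sub>F s in at t within {t..r}. \<phi> (k, s) = \<phi> (k, t)"
      using \<phi>[unfolded braid_coloring_def, THEN conjunct1, rule_format, of k t] that later t(2)
      by auto
    moreover have "at t within {t..r} = at_right t"
      using t(2) by (intro at_within_nhd[of _ "{..<r}"]) auto
    ultimately have "\<forall>\<^sub>F s in at_right t. \<phi> (k, s) = \<phi> (k, t)" by simp
    with eventually_at_right_less[of t] show ?thesis
      by eventually_elim (simp add: \<psi> start)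
  qed
  have left: "\<forall>\<^sub>F s in at_left t. \<psi> (k, s) = \<sigma> k" for k
    using t(1) by (auto simp: eventually_at_left_field \<psi>_def)
  have "braid_coloring (e # E) \<kappa> \<beta> n l r \<psi>"
    unfolding braid_coloring_def
  proof (intro conjI allI impI ballI, goal_cases)
    case (1 k s)
    consider "s < t" | "s = t" | "t < s" by linarith
    then show ?case
    proof cases
      case 1
      then have "\<forall>\<^sub>F s' in at s within {l..r}. s' < t"
        by (intro order_tendstoD(2)[OF tendsto_ident_at])
      then show ?thesis by eventually_elim (use 1 in \<open>simp add: \<psi>_def\<close>)
    next
      case 2
      then have "k \<noteq> j" using 1 by (auto simp: e)
      then have "\<sigma>' k = \<sigma> k" "\<psi> (k, t) = \<sigma> k" by (auto simp: \<sigma>'_def pass_def \<psi>_def)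
      then have "\<forall>\<^sub>F s' in at t. \<psi> (k, s') = \<psi> (k, t)"
        using left[of k] right[OF 1(1)] by (simp add: eventually_at_split)
      then show ?thesis using 2 by (auto intro: eventually_within_subset)
    next
      case 3
      then have "\<forall>\<^sub>F s' in at s within {l..r} \<inter> {t..r}. \<psi> (k, s') = \<psi> (k, s)"
        using glue(1)[of s k "{l..r}"] 1 by simp
      moreover have "at s within {l..r} \<inter> {t..r} = at s within {l..r}"
        using 3 by (intro at_within_nhd[of _ "{t<..}"]) auto
      ultimately show ?thesis by simp
    qed
  next
    case (2 x)
    then obtain s i' k e' where x: "x = (s, i', k, e')" by (metis prod_cases4)
    show ?case
    proof (cases "x = e")
      case True
      have "\<psi> (i, t) = \<sigma> i" by (simp add: \<psi>_def)
      then have "jump (\<lambda>s'. \<psi> (j, s')) t (\<kappa> j \<noteq> \<kappa> i) (d \<noteq> \<beta> i) (\<psi> (i, t))"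
        unfolding jump_def using left[of j] right[OF t(4)]
        by (intro exI[of _ "\<sigma> j"]) (simp add: \<sigma>'_def pass_def)
      then show ?thesis using True by (simp add: e)
    next
      case False
      then have "x \<in> set E" using 2 by simp
      moreover have "t < s" "s \<le> r" using \<open>x \<in> set E\<close> w' by (auto simp: x braid_word_def)
      ultimately show ?thesis using glue(2)[of s i' k e'] x by simp
    qed
  qed
  moreover have "\<psi> (k, l) = \<sigma> k" for k using t by (simp add: \<psi>_def)
  ultimately show ?case by blast
qed

section \<open>Words that list the crossings of a picture\<close>

definition represents ::
  "(real \<Rightarrow> complex) list \<Rightarrow> (point \<Rightarrow> point \<Rightarrow> bool) \<Rightarrow> crossing list \<Rightarrow> bool"
where
  "represents A R E \<longleftrightarrow> braid_word (length A) (-1) 1 E \<and>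
     (\<forall>(s, i, j, d) \<in> set E. crosses A R (i, s) (j, s) \<and> d = negative_det A (i, s) (j, s)) \<and>
     (\<forall>p \<in> strand_points A. \<forall>q \<in> strand_points A. crosses A R p q \<longrightarrow>
        snd p = snd q \<and> (\<exists>d. (snd p, fst p, fst q, d) \<in> set E))"

lemma local_coloring_iff_braid_coloring:
  assumes "represents A R E"
  shows "local_coloring A R \<kappa> \<beta> \<phi> \<longleftrightarrow> braid_coloring E \<kappa> \<beta> (length A) (-1) 1 \<phi>"
proof -
  have E: "crosses A R (i, s) (j, s) \<and> d = negative_det A (i, s) (j, s) \<and>
      (i, s) \<in> strand_points A \<and> (j, s) \<in> strand_points A" if "(s, i, j, d) \<in> set E" for s i j d
    using assms that by (fastforce simp: represents_def braid_word_def strand_points_def)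
  have E': "snd p = snd q \<and> (\<exists>d. (snd p, fst p, fst q, d) \<in> set E)"
    if "p \<in> strand_points A" "q \<in> strand_points A" "crosses A R p q" for p q
    using assms that unfolding represents_def by blast
  have over: "(\<forall>q \<in> strand_points A. \<not> crosses A R q (k, s)) \<longleftrightarrow> (\<forall>i d. (s, i, k, d) \<notin> set E)"
    if "(k, s) \<in> strand_points A" for k s
    using E E'[OF _ that] by fastforce
  have 1: "(\<forall>p \<in> strand_points A. (\<forall>q \<in> strand_points A. \<not> crosses A R q p) \<longrightarrow>
        (\<forall>\<^sub>F s in at (snd p) within {-1..1}. \<phi> (fst p, s) = \<phi> p)) \<longleftrightarrow>
     (\<forall>k < length A. \<forall>s \<in> {-1..1}. (\<forall>i d. (s, i, k, d) \<notin> set E) \<longrightarrow>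
        (\<forall>\<^sub>F s' in at s within {-1..1}. \<phi> (k, s') = \<phi> (k, s)))"
    using over by (auto simp: strand_points_def)
  have 2: "(\<forall>p \<in> strand_points A. \<forall>q \<in> strand_points A. crosses A R q p \<longrightarrow>
        jump (\<lambda>s. \<phi> (fst p, s)) (snd p) (\<kappa> (fst p) \<noteq> \<kappa> (fst q))
          (negative_det A q p \<noteq> \<beta> (fst q)) (\<phi> q)) \<longleftrightarrow>
     (\<forall>(s, i, k, d) \<in> set E.
        jump (\<lambda>s'. \<phi> (k, s')) s (\<kappa> k \<noteq> \<kappa> i) (d \<noteq> \<beta> i) (\<phi> (i, s)))" (is "?L \<longleftrightarrow> ?R")
  proof
    assume L: ?L
    show ?R
    proof (clarify)
      fix s i k d assume "(s, i, k, d) \<in> set E"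
      note e = E[OF this]
      then show "jump (\<lambda>s'. \<phi> (k, s')) s (\<kappa> k \<noteq> \<kappa> i) (d \<noteq> \<beta> i) (\<phi> (i, s))"
        using L[rule_format, of "(k, s)" "(i, s)"] by simp
    qed
  next
    assume R: ?R
    show ?L
    proof (intro ballI impI)
      fix p q assume pq: "p \<in> strand_points A" "q \<in> strand_points A" and cr: "crosses A R q p"
      obtain k s where p: "p = (k, s)" by fastforce
      obtain d where q: "q = (fst q, s)" and d: "(s, fst q, k, d) \<in> set E"
        using E'[OF pq(2,1) cr] by (cases q) (auto simp: p)
      have "d = negative_det A q p" using E[OF d] q p by simp
      then show "jump (\<lambda>s. \<phi> (fst p, s)) (snd p) (\<kappa> (fst p) \<noteq> \<kappa> (fst q))
          (negative_det A q p \<noteq> \<beta> (fst q)) (\<phi> q)"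
        using R d q by (fastforce simp: p)
    qed
  qed
  show ?thesis unfolding local_coloring_def braid_coloring_def 1 2 ..
qed

text \<open>The new coloring is propagated from the old colors at the left ends. It arrives at the
  old colors at the right ends because the two words act in the same way on tuples of
  colors.\<close>

lemma braid_extend:
  assumes "represents A R E" "represents B R F" "length A = length B"
    and run: "\<And>\<kappa> \<beta> \<sigma> k. k < length A \<Longrightarrow> fold (pass \<kappa> \<beta>) E \<sigma> k = fold (pass \<kappa> \<beta>) F \<sigma> k"
    and \<phi>: "local_coloring A R \<kappa> \<beta> \<phi>"
  shows "\<exists>\<phi>'. local_coloring B R \<kappa> \<beta> \<phi>' \<and>
    (\<forall>k < length A. \<phi>' (k, -1) = \<phi> (k, -1) \<and> \<phi>' (k, 1) = \<phi> (k, 1))"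
proof -
  have w: "braid_word (length A) (-1) 1 E" "braid_word (length A) (-1) 1 F"
    using assms(1-3) by (auto simp: represents_def)
  obtain \<phi>' where \<phi>': "braid_coloring F \<kappa> \<beta> (length A) (-1) 1 \<phi>'"
    and start: "\<And>k. \<phi>' (k, -1) = \<phi> (k, -1)"
    using braid_coloring_exists[OF w(2), where \<sigma> = "\<lambda>k. \<phi> (k, -1)" and \<kappa> = \<kappa> and \<beta> = \<beta>] by auto
  have "\<phi>' (k, 1) = \<phi> (k, 1)" if "k < length A" for k
    using braid_coloring_run[OF \<phi>' w(2) _ that] run[OF that] start
      braid_coloring_run[OF \<phi>[unfolded local_coloring_iff_braid_coloring[OF assms(1)]] w(1) _ that]
    by simp
  then show ?thesis
    using \<phi>' start local_coloring_iff_braid_coloring[OF assms(2)] assms(3) by auto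
qed

section \<open>The moves\<close>

lemma coloring_move_iff:
  assumes "local_move m A B R D D'" "virtual_diagram m D" "virtual_diagram m D'"
    and "length A = length B" "tame A" "tame B"
    and "\<And>\<kappa> \<beta> \<phi>. local_coloring A R \<kappa> \<beta> \<phi> \<Longrightarrow>
      \<exists>\<phi>'. local_coloring B R \<kappa> \<beta> \<phi>' \<and> (\<forall>k < length A. \<phi>' (k, -1) = \<phi> (k, -1) \<and> \<phi>' (k, 1) = \<phi> (k, 1))"
    and "\<And>\<kappa> \<beta> \<phi>. local_coloring B R \<kappa> \<beta> \<phi> \<Longrightarrow>
      \<exists>\<phi>'. local_coloring A R \<kappa> \<beta> \<phi>' \<and> (\<forall>k < length B. \<phi>' (k, -1) = \<phi> (k, -1) \<and> \<phi>' (k, 1) = \<phi> (k, 1))"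
  shows "(\<exists>f. coloring m D f) \<longleftrightarrow> (\<exists>f. coloring m D' f)"
  using coloring_local_move[OF assms(1-7)]
    coloring_local_move[OF local_move_sym[OF assms(1,4)] assms(3,2) assms(4)[symmetric] assms(6,5,8)]
  by blast

lemma coloring_braid_move_iff:
  assumes "local_move m A B R D D'" "virtual_diagram m D" "virtual_diagram m D'"
    and "length A = length B" "tame A" "tame B" "represents A R E" "represents B R F"
    and "\<And>\<kappa> \<beta> \<sigma> k. k < length A \<Longrightarrow> fold (pass \<kappa> \<beta>) E \<sigma> k = fold (pass \<kappa> \<beta>) F \<sigma> k"
  shows "(\<exists>f. coloring m D f) \<longleftrightarrow> (\<exists>f. coloring m D' f)"
proof (rule coloring_move_iff[OF assms(1-6)])
  fix \<kappa> \<beta> \<phi>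
  show "\<exists>\<phi>'. local_coloring B R \<kappa> \<beta> \<phi>' \<and> (\<forall>k < length A. \<phi>' (k, -1) = \<phi> (k, -1) \<and> \<phi>' (k, 1) = \<phi> (k, 1))"
    if "local_coloring A R \<kappa> \<beta> \<phi>"
    by (rule braid_extend[OF assms(7,8,4,9) that])
  show "\<exists>\<phi>'. local_coloring A R \<kappa> \<beta> \<phi>' \<and> (\<forall>k < length B. \<phi>' (k, -1) = \<phi> (k, -1) \<and> \<phi>' (k, 1) = \<phi> (k, 1))"
    if "local_coloring B R \<kappa> \<beta> \<phi>"
    by (rule braid_extend[OF assms(8,7) assms(4)[symmetric] assms(9)[symmetric] that]) (simp add: assms(4))
qed

section \<open>Pictures made of graphs of functions\<close>

lemma graph_arc_has_vector_derivative:
  assumes "(f has_real_derivative f') (at s)"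
  shows "(graph_arc f has_vector_derivative Complex 1 f') (at s)"
proof -
  have "((\<lambda>s. s *\<^sub>R 1 + f s *\<^sub>R \<i>) has_vector_derivative 1 *\<^sub>R 1 + f' *\<^sub>R \<i>) (at s)"
    using assms by (auto intro!: derivative_eq_intros)
  moreover have "(\<lambda>s. s *\<^sub>R 1 + f s *\<^sub>R \<i>) = graph_arc f"
    by (auto simp: graph_arc_def complex_eq_iff)
  moreover have "1 *\<^sub>R 1 + f' *\<^sub>R \<i> = Complex 1 f'" by (simp add: complex_eq_iff)
  ultimately show ?thesis by simp
qed

lemma crosses_graph:
  assumes "p \<in> strand_points (map graph_arc fs)" "q \<in> strand_points (map graph_arc fs)"
  shows "crosses (map graph_arc fs) R p q \<longleftrightarrow>
    fst p \<noteq> fst q \<and> snd p = snd q \<and> (fs ! fst p) (snd p) = (fs ! fst q) (snd p) \<and> R p q"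
  using assms by (cases p; cases q) (auto simp: crosses_def strand_points_def graph_arc_def)

lemma tame_graph:
  assumes "\<And>k s. k < length fs \<Longrightarrow> \<bar>s\<bar> \<le> 1 \<Longrightarrow> \<bar>(fs ! k) s\<bar> \<le> 1"
    and "\<And>k l s. k < length fs \<Longrightarrow> l < length fs \<Longrightarrow> k \<noteq> l \<Longrightarrow> \<bar>s\<bar> = 1 \<Longrightarrow> (fs ! k) s \<noteq> (fs ! l) s"
  shows "tame (map graph_arc fs)"
  unfolding tame_def
proof (intro conjI ballI impI)
  fix p assume "p \<in> strand_points (map graph_arc fs)"
  then show "(map graph_arc fs ! fst p) (snd p) \<in> square"
    using assms(1)[of "fst p" "snd p"] by (auto simp: strand_points_def square_def graph_arc_def abs_le_iff)
next
  fix p q assume pq: "p \<in> strand_points (map graph_arc fs)" "q \<in> strand_points (map graph_arc fs)" "p \<noteq> q"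
    "(map graph_arc fs ! fst p) (snd p) = (map graph_arc fs ! fst q) (snd q)"
  then have "crosses (map graph_arc fs) (\<lambda>_ _. True) p q" by (simp add: crosses_def)
  then have c: "fst p \<noteq> fst q" "(fs ! fst p) (snd p) = (fs ! fst q) (snd p)"
    using crosses_graph[OF pq(1,2)] by blast+
  show "\<bar>snd p\<bar> < 1"
  proof (rule ccontr)
    assume "\<not> \<bar>snd p\<bar> < 1"
    then have "\<bar>snd p\<bar> = 1" using pq(1) by (auto simp: strand_points_def)
    then show False using assms(2)[of "fst p" "fst q" "snd p"] c pq by (auto simp: strand_points_def)
  qed
qed

text \<open>Both velocities have first coordinate 1, so the determinant is the difference
  \<open>y - x\<close> of the slopes.\<close>

lemma negative_det_graph:
  assumes "i < length fs" "j < length fs"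
    and "((fs ! i) has_real_derivative x) (at s)" "((fs ! j) has_real_derivative y) (at s)"
  shows "negative_det (map graph_arc fs) (i, s) (j, s) \<longleftrightarrow> y < x"
  using assms
  by (simp add: negative_det_def graph_arc_has_vector_derivative[THEN vector_derivative_at] planar_det_def)

lemma represents_graph:
  assumes w: "braid_word (length fs) (-1) 1 E"
    and deriv: "\<And>k s. k < length fs \<Longrightarrow> ((fs ! k) has_real_derivative (fs' ! k) s) (at s)"
    and E: "\<forall>(s, i, j, d) \<in> set E. (fs ! i) s = (fs ! j) s \<and> R (i, s) (j, s) \<and>
      (d \<longleftrightarrow> (fs' ! j) s < (fs' ! i) s)"
    and all: "\<And>s i j. \<bar>s\<bar> \<le> 1 \<Longrightarrow> i < length fs \<Longrightarrow> j < length fs \<Longrightarrow> i \<noteq> j \<Longrightarrow>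
      (fs ! i) s = (fs ! j) s \<Longrightarrow> R (i, s) (j, s) \<Longrightarrow> \<exists>d. (s, i, j, d) \<in> set E"
  shows "represents (map graph_arc fs) R E"
  unfolding represents_def
proof (intro conjI ballI impI)
  show "braid_word (length (map graph_arc fs)) (-1) 1 E" using w by simp
next
  fix e assume e: "e \<in> set E"
  obtain s i j d where s: "e = (s, i, j, d)" by (metis prod_cases4)
  have b: "-1 < s" "s < 1" "i < length fs" "j < length fs" "i \<noteq> j"
    using w e by (auto simp: s braid_word_def)
  then have "(i, s) \<in> strand_points (map graph_arc fs)" "(j, s) \<in> strand_points (map graph_arc fs)"
    by (auto simp: strand_points_def)
  then show "case e of (s, i, j, d) \<Rightarrow> crosses (map graph_arc fs) R (i, s) (j, s) \<and>
      d = negative_det (map graph_arc fs) (i, s) (j, s)"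
    using bspec[OF E e] b negative_det_graph[OF b(3,4) deriv deriv, OF b(3,4)]
    by (auto simp: s crosses_graph)
next
  fix p q assume pq: "p \<in> strand_points (map graph_arc fs)" "q \<in> strand_points (map graph_arc fs)"
    and "crosses (map graph_arc fs) R p q"
  then have c: "fst p \<noteq> fst q" "snd p = snd q" "(fs ! fst p) (snd p) = (fs ! fst q) (snd p)" "R p q"
    using crosses_graph by blast+
  show "snd p = snd q" by (rule c)
  show "\<exists>d. (snd p, fst p, fst q, d) \<in> set E"
    by (rule all) (use pq c in \<open>auto simp: strand_points_def\<close>)
qed

text \<open>One double point under an arbitrary rule: \<open>d\<close> is the sign if
  \<open>i\<close> is the over strand, exchanging the roles negates it, and a virtual crossing
  leaves no entry. Thus classical, mixed and virtual moves share the same words.\<close>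

definition crossing_at :: "(nat \<Rightarrow> nat \<Rightarrow> bool) \<Rightarrow> real \<Rightarrow> nat \<Rightarrow> nat \<Rightarrow> bool \<Rightarrow> crossing list" where
  "crossing_at \<rho> s i j d =
     (if \<rho> i j then [(s, i, j, d)] else if \<rho> j i then [(s, j, i, \<not> d)] else [])"

section \<open>Crossings of the elementary pictures\<close>

lemma cos_pi_eq_0:
  assumes "\<bar>s\<bar> \<le> 1" "cos (pi * s) = 0"
  shows "s = 1/2 \<or> s = -1/2"
proof -
  obtain i where i: "odd i" "pi * s = of_int i * (pi / 2)"
    using assms(2) by (auto simp: cos_zero_iff_int)
  then have s: "s = of_int i / 2" by simp
  then have "\<bar>i\<bar> \<le> 2" using assms(1) by linarith
  then have "i = 1 \<or> i = -1" using i(1) by presburger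
  then show ?thesis using s by auto
qed

lemma cos_2pi_eq_0:
  assumes "\<bar>s\<bar> \<le> 1" "cos (2 * pi * s) = 0"
  shows "s = -3/4 \<or> s = -1/4 \<or> s = 1/4 \<or> s = 3/4"
proof -
  obtain i where i: "odd i" "2 * pi * s = of_int i * (pi / 2)"
    using assms(2) by (auto simp: cos_zero_iff_int)
  then have s: "s = of_int i / 4" by simp
  then have "\<bar>i\<bar> \<le> 4" using assms(1) by linarith
  then have "i = 1 \<or> i = -1 \<or> i = 3 \<or> i = -3" using i(1) by presburger
  then show ?thesis using s by auto
qed

text \<open>The right-hand side is nonnegative, which forces \<open>0 \<le> s\<close>. On
  \<open>{0..1}\<close> the cosine decreases through 0 at \<open>s = 1/2\<close> while the line
  increases, so they meet only there.\<close>

lemma line_meets_cosine: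
  assumes "\<bar>s\<bar> \<le> 1" "2 * s = 1 + cos (pi * s)"
  shows "s = 1/2"
proof -
  have "0 \<le> s" using assms(2) cos_ge_minus_one[of "pi * s"] by linarith
  then have b: "0 \<le> pi * s" "pi * s \<le> pi" using assms(1) by auto
  consider "s < 1/2" | "s = 1/2" | "1/2 < s" by linarith
  then show ?thesis
  proof cases
    case 1
    then have "cos (pi / 2) < cos (pi * s)" using b by (intro cos_monotone_0_pi) auto
    then show ?thesis using 1 assms(2) by simp
  next
    case 3
    then have "cos (pi * s) < cos (pi / 2)" using b by (intro cos_monotone_0_pi) auto
    then show ?thesis using 3 assms(2) by simp
  qed
qed

lemma parallel_graph: "parallel = map graph_arc [\<lambda>s. 1/2, \<lambda>s. - 1/2]"
  by (simp add: parallel_def)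

lemma bigon_graph: "bigon = map graph_arc [\<lambda>s. - cos (pi * s) / 2, \<lambda>s. cos (pi * s) / 2]"
  by (simp add: bigon_def)

lemma four_twist_graph:
  "four_twist = map graph_arc [\<lambda>s. cos (2 * pi * s) / 2, \<lambda>s. - cos (2 * pi * s) / 2]"
  by (simp add: four_twist_def)

lemma triangle_above_graph:
  "triangle_above = map graph_arc [\<lambda>s. s / 2, \<lambda>s. - s / 2, \<lambda>s. (1 + cos (pi * s)) / 4]"
  by (simp add: triangle_above_def)

lemma triangle_below_graph:
  "triangle_below = map graph_arc [\<lambda>s. s / 2, \<lambda>s. - s / 2, \<lambda>s. - (1 + cos (pi * s)) / 4]"
  by (simp add: triangle_below_def)

lemma abs_eq_1: "\<bar>s :: real\<bar> = 1 \<longleftrightarrow> s = 1 \<or> s = -1" by auto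

lemma cos_bounds:
  fixes x :: real
  shows "\<bar>cos x\<bar> \<le> 2" "\<bar>1 + cos x\<bar> \<le> 4" "cos x \<le> 3"
  using abs_cos_le_one[of x] by linarith+

lemma tame_parallel: "tame parallel"
  unfolding parallel_graph
  by (rule tame_graph) (auto simp: less_Suc_eq)

lemma tame_bigon: "tame bigon"
  unfolding bigon_graph
proof (rule tame_graph)
  fix k s assume "k < length [\<lambda>s. - cos (pi * s) / 2, \<lambda>s. cos (pi * s) / 2]"
  then show "\<bar>([\<lambda>s. - cos (pi * s) / 2, \<lambda>s. cos (pi * s) / 2] ! k) s\<bar> \<le> 1"
    by (auto simp: less_Suc_eq cos_bounds)
qed (auto simp: less_Suc_eq abs_eq_1)

lemma tame_four_twist: "tame four_twist"
  unfolding four_twist_graph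
proof (rule tame_graph)
  fix k s assume "k < length [\<lambda>s. cos (2 * pi * s) / 2, \<lambda>s. - cos (2 * pi * s) / 2]"
  then show "\<bar>([\<lambda>s. cos (2 * pi * s) / 2, \<lambda>s. - cos (2 * pi * s) / 2] ! k) s\<bar> \<le> 1"
    by (auto simp: less_Suc_eq cos_bounds)
qed (auto simp: less_Suc_eq abs_eq_1)

lemma tame_triangle_above: "tame triangle_above"
  unfolding triangle_above_graph
proof (rule tame_graph)
  fix k and s :: real assume "k < length [\<lambda>s. s / 2, \<lambda>s. - s / 2, \<lambda>s. (1 + cos (pi * s)) / 4]" "\<bar>s\<bar> \<le> 1"
  then show "\<bar>([\<lambda>s. s / 2, \<lambda>s. - s / 2, \<lambda>s. (1 + cos (pi * s)) / 4] ! k) s\<bar> \<le> 1"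
    by (auto simp: less_Suc_eq cos_bounds)
qed (auto simp: less_Suc_eq abs_eq_1)

lemma tame_triangle_below: "tame triangle_below"
  unfolding triangle_below_graph
proof (rule tame_graph)
  fix k and s :: real assume "k < length [\<lambda>s. s / 2, \<lambda>s. - s / 2, \<lambda>s. - (1 + cos (pi * s)) / 4]" "\<bar>s\<bar> \<le> 1"
  then show "\<bar>([\<lambda>s. s / 2, \<lambda>s. - s / 2, \<lambda>s. - (1 + cos (pi * s)) / 4] ! k) s\<bar> \<le> 1"
    by (auto simp: less_Suc_eq cos_bounds)
qed (auto simp: less_Suc_eq abs_eq_1)

lemma represents_parallel: "represents parallel R []"
  unfolding parallel_graph
  by (rule represents_graph[where fs' = "[\<lambda>_. 0, \<lambda>_. 0]"]) (auto simp: braid_word_def less_Suc_eq)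

lemma represents_bigon:
  assumes R: "\<And>p q. R p q \<longleftrightarrow> \<rho> (fst p) (fst q)" and asym: "\<And>i j. \<rho> i j \<Longrightarrow> \<not> \<rho> j i"
  shows "represents bigon R (crossing_at \<rho> (-1/2) 0 1 False @ crossing_at \<rho> (1/2) 0 1 True)"
    (is "represents _ _ ?E")
  unfolding bigon_graph
proof (rule represents_graph[where
      fs' = "[\<lambda>s. pi * sin (pi * s) / 2, \<lambda>s. - (pi * sin (pi * s)) / 2]"], goal_cases)
  case 1
  show ?case by (auto simp: crossing_at_def braid_word_def)
next
  case (2 k s)
  then show ?case by (auto simp: less_Suc_eq intro!: derivative_eq_intros)
next
  case 3
  show ?case by (auto simp: crossing_at_def R)
next
  case (4 s i j)
  then show ?case
    using cos_pi_eq_0[of s] asym by (auto simp: crossing_at_def R less_Suc_eq)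
qed

text \<open>Each strand has slopes of alternating sign at its four crossings. Fixing the sign of the
  slope of the over strand therefore makes the over strand alternate: each strand passes under
  twice, and all four crossings have the same \<open>d\<close>.\<close>

lemma represents_four_twist:
  "represents four_twist (over_slope 1)
     [(-3/4, 1, 0, True), (-1/4, 0, 1, True), (1/4, 1, 0, True), (3/4, 0, 1, True)]"
  "represents four_twist (over_slope (-1))
     [(-3/4, 0, 1, False), (-1/4, 1, 0, False), (1/4, 0, 1, False), (3/4, 1, 0, False)]"
proof -
  let ?fs = "[\<lambda>s. cos (2 * pi * s) / 2, \<lambda>s. - cos (2 * pi * s) / 2]"
  let ?fs' = "[\<lambda>s. - (pi * sin (2 * pi * s)), \<lambda>s. pi * sin (2 * pi * s)]"
  have d: "((?fs ! k) has_real_derivative (?fs' ! k) s) (at s)" if "k < length ?fs" for k s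
    using that by (auto simp: less_Suc_eq intro!: derivative_eq_intros)
  have slope: "over_slope \<epsilon> (k, s) q \<longleftrightarrow> 0 < \<epsilon> * (?fs' ! k) s" if "k < length ?fs" for \<epsilon> k s q
  proof -
    have "(\<lambda>s. Im ((four_twist ! k) s)) = ?fs ! k"
      using that by (auto simp: four_twist_graph graph_arc_def less_Suc_eq)
    then show ?thesis using DERIV_imp_deriv[OF d[OF that]] by (simp add: over_slope_def)
  qed
  have quarter: "cos (3 * pi / 2) = 0" "sin (3 * pi / 2) = - 1"
    using cos_3over2_pi sin_3over2_pi by (simp_all add: mult.commute)
  show "represents four_twist (over_slope 1)
     [(-3/4, 1, 0, True), (-1/4, 0, 1, True), (1/4, 1, 0, True), (3/4, 0, 1, True)]"
    unfolding four_twist_graph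
  proof (rule represents_graph[where fs' = ?fs'], goal_cases)
    case 1
    show ?case by (simp add: braid_word_def)
  next
    case (2 k s)
    then show ?case by (rule d)
  next
    case 3
    show ?case
      by (simp only: list.set ball_simps prod.case) (simp add: slope quarter)
  next
    case (4 s i j)
    then have "cos (2 * pi * s) = 0" by (auto simp: less_Suc_eq)
    with 4(1) consider "s = -3/4" | "s = -1/4" | "s = 1/4" | "s = 3/4" using cos_2pi_eq_0 by blast
    then show ?case
      using 4 by cases (auto simp: less_Suc_eq slope quarter)
  qed
  show "represents four_twist (over_slope (-1))
     [(-3/4, 0, 1, False), (-1/4, 1, 0, False), (1/4, 0, 1, False), (3/4, 1, 0, False)]"
    unfolding four_twist_graph
  proof (rule represents_graph[where fs' = ?fs'], goal_cases)
    case 1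
    show ?case by (simp add: braid_word_def)
  next
    case (2 k s)
    then show ?case by (rule d)
  next
    case 3
    show ?case
      by (simp only: list.set ball_simps prod.case) (simp add: slope quarter)
  next
    case (4 s i j)
    then have "cos (2 * pi * s) = 0" by (auto simp: less_Suc_eq)
    with 4(1) consider "s = -3/4" | "s = -1/4" | "s = 1/4" | "s = 3/4" using cos_2pi_eq_0 by blast
    then show ?case
      using 4 by cases (auto simp: less_Suc_eq slope quarter)
  qed
qed

text \<open>Strand 2 meets the descending strand 1 to the left of the origin and the ascending
  strand 0 to the right of it. In \<open>triangle_below\<close> the order is the opposite
  one.\<close>

lemma represents_triangle_above:
  assumes R: "\<And>p q. R p q \<longleftrightarrow> \<rho> (fst p) (fst q)" and asym: "\<And>i j. \<rho> i j \<Longrightarrow> \<not> \<rho> j i"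
  shows "represents triangle_above R
    (crossing_at \<rho> (-1/2) 1 2 False @ crossing_at \<rho> 0 0 1 True @ crossing_at \<rho> (1/2) 0 2 True)"
  unfolding triangle_above_graph
proof (rule represents_graph[where
      fs' = "[\<lambda>s. 1/2, \<lambda>s. - 1/2, \<lambda>s. - (pi * sin (pi * s)) / 4]"], goal_cases)
  case 1
  show ?case by (auto simp: crossing_at_def braid_word_def)
next
  case (2 k s)
  then show ?case by (auto simp: less_Suc_eq intro!: derivative_eq_intros)
next
  case 3
  have "- 2 < pi" "\<not> pi < - 2" using pi_gt_zero by linarith+
  then show ?case by (auto simp: crossing_at_def R)
next
  case (4 s i j)
  have "2 * s \<noteq> 1 + cos (pi * s) \<or> s = 1/2" using line_meets_cosine 4(1) by blast
  moreover have "- (2 * s) \<noteq> 1 + cos (pi * s) \<or> s = -1/2"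
    using line_meets_cosine[of "-s"] 4(1) by auto
  ultimately have "(i = 0 \<and> j = 1 \<or> i = 1 \<and> j = 0) \<and> s = 0 \<or>
      (i = 0 \<and> j = 2 \<or> i = 2 \<and> j = 0) \<and> s = 1/2 \<or>
      (i = 1 \<and> j = 2 \<or> i = 2 \<and> j = 1) \<and> s = -1/2"
    using 4(2-5) by (elim disjE) (auto simp: less_Suc_eq numeral_2_eq_2 field_simps)
  then show ?case
    using 4(6) asym by (auto simp: crossing_at_def R)
qed

lemma represents_triangle_below:
  assumes R: "\<And>p q. R p q \<longleftrightarrow> \<rho> (fst p) (fst q)" and asym: "\<And>i j. \<rho> i j \<Longrightarrow> \<not> \<rho> j i"
  shows "represents triangle_below R
    (crossing_at \<rho> (-1/2) 0 2 True @ crossing_at \<rho> 0 0 1 True @ crossing_at \<rho> (1/2) 1 2 False)"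
  unfolding triangle_below_graph
proof (rule represents_graph[where
      fs' = "[\<lambda>s. 1/2, \<lambda>s. - 1/2, \<lambda>s. pi * sin (pi * s) / 4]"], goal_cases)
  case 1
  show ?case by (auto simp: crossing_at_def braid_word_def)
next
  case (2 k s)
  then show ?case by (auto simp: less_Suc_eq intro!: derivative_eq_intros)
next
  case 3
  have "- 2 < pi" "\<not> pi < - 2" using pi_gt_zero by linarith+
  then show ?case by (auto simp: crossing_at_def R)
next
  case (4 s i j)
  have "2 * s \<noteq> 1 + cos (pi * s) \<or> s = 1/2" using line_meets_cosine 4(1) by blast
  moreover have "- (2 * s) \<noteq> 1 + cos (pi * s) \<or> s = -1/2"
    using line_meets_cosine[of "-s"] 4(1) by auto
  ultimately have "(i = 0 \<and> j = 1 \<or> i = 1 \<and> j = 0) \<and> s = 0 \<or>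
      (i = 0 \<and> j = 2 \<or> i = 2 \<and> j = 0) \<and> s = -1/2 \<or>
      (i = 1 \<and> j = 2 \<or> i = 2 \<and> j = 1) \<and> s = 1/2"
    using 4(2-5) by (elim disjE) (auto simp: less_Suc_eq numeral_2_eq_2 field_simps)
  then show ?case
    using 4(6) asym by (auto simp: crossing_at_def R)
qed

section \<open>The color identities behind the moves\<close>

lemma bigon_run:
  "fold (pass \<kappa> \<beta>) (crossing_at \<rho> s 0 1 False @ crossing_at \<rho> t 0 1 True) \<sigma> k = \<sigma> k"
  by (auto simp: pass_def crossing_at_def act_inverse')

text \<open>The disjuncts are the over relations of the classical, virtual and mixed triangle moves
  and of commuting overcrossings. A strand passing under two strands that cross virtually is
  excluded: there the order of the two steps matters if their flags differ.\<close>

definition admissible :: "(nat \<Rightarrow> nat \<Rightarrow> bool) \<Rightarrow> bool" where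
  "admissible \<rho> \<longleftrightarrow> (\<exists>h. inj h \<and> \<rho> = (\<lambda>i j. h j < (h i :: nat))) \<or> \<rho> = (\<lambda>i j. False) \<or>
    (\<exists>k l. {k, l} = {0, 1} \<and> \<rho> = (\<lambda>i j. i = k \<and> j = l)) \<or> \<rho> = (\<lambda>i j. i = 2 \<and> j \<in> {0, 1})"

text \<open>Write \<open>A\<close> and \<open>B\<close> for the first bits of the two strands and
  \<open>i\<close> for their flag. Between the two undercrossings of a strand the other one passes
  under once, so the two steps add \<open>A + B\<close> and \<open>(A + i) + (B + i)\<close> to
  \<open>r\<close>, together with the same sign term twice. Modulo 2 this is 0, and \<open>A\<close>
  returns as well.\<close>

lemma four_twist_run:
  "fold (pass \<kappa> \<beta>) [(s, 1, 0, d), (s', 0, 1, d), (t, 1, 0, d), (t', 0, 1, d)] \<sigma> = \<sigma>"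
  "fold (pass \<kappa> \<beta>) [(s, 0, 1, d), (s', 1, 0, d), (t, 0, 1, d), (t', 1, 0, d)] \<sigma> = \<sigma>"
proof -
  have twist: "act i e (act i e u w) (act i f w (act i e u w)) = u"
    "act i f (act i f w (act i e u w)) u = w" for i e f u w
  proof -
    obtain a b c d where "u = (a, b)" "w = (c, d)" by fastforce
    then show "act i e (act i e u w) (act i f w (act i e u w)) = u"
      "act i f (act i f w (act i e u w)) u = w"
      by (cases a; cases b; cases c; cases d; cases i; cases e; cases f; simp add: act_def)+
  qed
  have \<kappa>: "(\<kappa> 1 \<noteq> \<kappa> 0) = (\<kappa> 0 \<noteq> \<kappa> 1)" by auto
  show "fold (pass \<kappa> \<beta>) [(s, 1, 0, d), (s', 0, 1, d), (t, 1, 0, d), (t', 0, 1, d)] \<sigma> = \<sigma>"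
    by (rule ext) (simp add: pass_def \<kappa> twist del: not_iff One_nat_def)
  show "fold (pass \<kappa> \<beta>) [(s, 0, 1, d), (s', 1, 0, d), (t, 0, 1, d), (t', 1, 0, d)] \<sigma> = \<sigma>"
    by (rule ext) (simp add: pass_def \<kappa> twist del: not_iff One_nat_def)
qed

text \<open>When all three crossings are classical, the six height orders reduce to
  self-distributivity. In the other cases at most two classical crossings remain, and the updates do
  not interfere.\<close>

lemma triangle_run:
  assumes "admissible \<rho>" "k < 3"
  shows "fold (pass \<kappa> \<beta>)
      (crossing_at \<rho> (-1/2) 1 2 False @ crossing_at \<rho> 0 0 1 True @ crossing_at \<rho> (1/2) 0 2 True) \<sigma> k =
    fold (pass \<kappa> \<beta>)
      (crossing_at \<rho> (-1/2) 0 2 True @ crossing_at \<rho> 0 0 1 True @ crossing_at \<rho> (1/2) 1 2 False) \<sigma> k"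
  using assms(1) unfolding admissible_def
proof (elim disjE)
  assume "\<exists>h. inj h \<and> \<rho> = (\<lambda>i j. h j < (h i :: nat))"
  then obtain h :: "nat \<Rightarrow> nat" where h: "inj h" "\<rho> = (\<lambda>i j. h j < h i)" by (elim exE conjE)
  have ne: "h 0 \<noteq> h 1" "h 0 \<noteq> h 2" "h 1 \<noteq> h 2" using h(1) by (simp_all add: inj_eq)
  then consider "h 0 < h 1" "h 0 < h 2" "h 1 < h 2" | "h 0 < h 1" "h 0 < h 2" "h 2 < h 1"
    | "h 1 < h 0" "h 1 < h 2" "h 0 < h 2" | "h 1 < h 0" "h 1 < h 2" "h 2 < h 0"
    | "h 2 < h 0" "h 2 < h 1" "h 0 < h 1" | "h 2 < h 0" "h 2 < h 1" "h 1 < h 0"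
    by linarith
  note order = this
  have D: "act i d (act j e u v) w = act j e (act i d u w) (act l d v w)"
    if "(i \<noteq> j) = l" for i j l d e u v w
    by (rule act_distrib) (use that in auto)
  \<comment> \<open>The form of \<open>D\<close> in which the middle strand is given by its color on
    the other side of its passage under the top strand.\<close>
  have D': "act i d (act j e u (act l d' v w)) w = act j e (act i d u w) v"
    if "(i \<noteq> j) = l" "d' = (\<not> d)" for i j l d d' e u v w
    using D[OF that(1), of d e u "act l d' v w" w] act_inverse'[of d d' l v w] that(2) by simp
  show ?thesis
    by (cases rule: order)
      (simp_all add: h(2) crossing_at_def pass_def,
        ((intro impI)?, (rule D D[symmetric] D' D'[symmetric]; auto))+)
next
  assume "\<exists>k l. {k, l} = {0, 1} \<and> \<rho> = (\<lambda>i j. i = k \<and> j = l)"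
  then show ?thesis by (auto simp: crossing_at_def doubleton_eq_iff pass_def)
qed (auto simp: crossing_at_def pass_def act_commute)

section \<open>Kinks\<close>

lemma curl_double_points:
  assumes "p \<in> strand_points curl" "q \<in> strand_points curl" "p \<noteq> q"
    "(curl ! fst p) (snd p) = (curl ! fst q) (snd q)"
  shows "(p = (0, -1/2) \<and> q = (0, 1/2)) \<or> (p = (0, 1/2) \<and> q = (0, -1/2))"
proof -
  obtain s t where st: "p = (0, s)" "q = (0, t)" "\<bar>s\<bar> \<le> 1" "\<bar>t\<bar> \<le> 1"
    using assms(1,2) by (auto simp: strand_points_def curl_def)
  have im: "(1 - s\<^sup>2)\<^sup>2 = (1 - t\<^sup>2)\<^sup>2"
    and re: "s - 16/9 * s * (1 - s\<^sup>2)\<^sup>2 = t - 16/9 * t * (1 - t\<^sup>2)\<^sup>2"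
    using arg_cong[OF assms(4), of Im] arg_cong[OF assms(4), of Re] by (simp_all add: st curl_def)
  have "0 \<le> 1 - s\<^sup>2" "0 \<le> 1 - t\<^sup>2" using st by (simp_all add: abs_square_le_1)
  then have "1 - s\<^sup>2 = 1 - t\<^sup>2" using im by (simp add: power2_eq_iff_nonneg)
  then have t: "t = - s" using assms(3) st(1,2) by (auto simp: power2_eq_iff)
  \<comment> \<open>This explains the coefficient of the curl: 16/9 is the reciprocal of the square
    of 3/4, which is the value of \<open>1 - s\<^sup>2\<close> at \<open>s = 1/2\<close>.\<close>
  then have "s * (1 - 16/9 * (1 - s\<^sup>2)\<^sup>2) = 0" using re by (simp add: algebra_simps)
  moreover have "s \<noteq> 0" using t assms(3) st(1,2) by auto
  ultimately have "(1 - s\<^sup>2)\<^sup>2 = (3/4)\<^sup>2" by (simp add: power2_eq_square)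
  then have "1 - s\<^sup>2 = 3/4" using \<open>0 \<le> 1 - s\<^sup>2\<close> by (simp add: power2_eq_iff_nonneg)
  then have "s\<^sup>2 = (1/2)\<^sup>2" by (simp add: power2_eq_square)
  then have "s = 1/2 \<or> s = -1/2" by (simp only: power2_eq_iff) auto
  then show ?thesis using t st by auto
qed

lemma tame_curl: "tame curl"
  unfolding tame_def
proof (intro conjI ballI impI)
  fix p assume "p \<in> strand_points curl"
  then obtain s where s: "p = (0, s)" "\<bar>s\<bar> \<le> 1" by (auto simp: strand_points_def curl_def)
  define y where "y = (1 - s\<^sup>2)\<^sup>2"
  have "0 \<le> 1 - s\<^sup>2" "1 - s\<^sup>2 \<le> 1" using s by (simp_all add: abs_square_le_1)
  then have y: "0 \<le> y" "y \<le> 1" unfolding y_def by (simp_all add: power_le_one)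
  have "\<bar>s * (1 - 16/9 * y)\<bar> \<le> 1 * 1"
    unfolding abs_mult by (rule mult_mono) (use s y in auto)
  then have "\<bar>s - 16/9 * s * y\<bar> \<le> 1" by (simp add: algebra_simps)
  then show "(curl ! fst p) (snd p) \<in> square"
    using y by (simp add: curl_def s square_def y_def)
next
  fix p q assume "p \<in> strand_points curl" "q \<in> strand_points curl" "p \<noteq> q"
    "(curl ! fst p) (snd p) = (curl ! fst q) (snd q)"
  from curl_double_points[OF this] show "\<bar>snd p\<bar> < 1" by auto
qed

lemma tame_straight: "tame straight"
  using tame_graph[of "[\<lambda>s. 0]"] by (simp add: straight_def)

text \<open>A single strand can only cross itself, and a step under an arc of the same color and
  component does nothing, whatever the sign.\<close>

lemma local_coloring_const:
  assumes "length A = 1"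
  shows "local_coloring A R \<kappa> \<beta> (\<lambda>_. w)"
  using assms by (auto simp: local_coloring_def strand_points_def act_self intro!: jump_const)

text \<open>\<open>S\<close> and \<open>T\<close> are the parts of the strand before and after its
  undercrossing \<open>u\<close>. The over branch \<open>v\<close> lies on one of them, so its color
  is that of the arc before or of the arc after; \<open>act_self\<close> settles the first case and
  \<open>act_eq_self\<close> the second.\<close>

lemma jump_return:
  assumes "connected S" "connected T" "-1 \<in> S" "1 \<in> T"
    and S: "\<And>x. x \<in> S \<Longrightarrow> \<forall>\<^sub>F y in at x within S. g y = g x"
    and T: "\<And>x. x \<in> T \<Longrightarrow> \<forall>\<^sub>F y in at x within T. g y = g x"
    and j: "jump g u False d (g v)" and v: "v \<in> S \<union> T"
    and near: "\<forall>\<^sub>F y in at_left u. y \<in> S" "\<forall>\<^sub>F y in at_right u. y \<in> T"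
  shows "g (-1) = (g 1 :: color)"
proof -
  have gS: "g x = g (-1)" if "x \<in> S" for x
    by (rule locally_constant_on_connected[of S g, OF assms(1) S that assms(3)])
  have gT: "g x = g 1" if "x \<in> T" for x
    by (rule locally_constant_on_connected[of T g, OF assms(2) T that assms(4)])
  obtain c where c: "\<forall>\<^sub>F y in at_left u. g y = c" "\<forall>\<^sub>F y in at_right u. g y = act False d c (g v)"
    using j by (auto simp: jump_def)
  have "\<forall>\<^sub>F y in at_left u. g (-1) = c" using c(1) near(1) by eventually_elim (use gS in auto)
  then have 1: "c = g (-1)" by simp
  have "\<forall>\<^sub>F y in at_right u. g 1 = act False d c (g v)" using c(2) near(2) by eventually_elim (use gT in auto)
  then have 2: "g 1 = act False d (g (-1)) (g v)" using 1 by simp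
  consider "g v = g (-1)" | "g v = g 1" using v gS gT by blast
  then show ?thesis
  proof cases
    case 1
    then show ?thesis using 2 by (simp add: act_self)
  next
    case 2
    then show ?thesis using \<open>g 1 = act False d (g (-1)) (g v)\<close> act_eq_self by metis
  qed
qed

lemma curl_coloring_ends:
  assumes \<phi>: "local_coloring curl R \<kappa> \<beta> \<phi>" and asym: "\<And>p q. R p q \<Longrightarrow> \<not> R q p"
  shows "\<phi> (0, -1) = \<phi> (0, 1)"
proof -
  have SP: "(0, s) \<in> strand_points curl \<longleftrightarrow> s \<in> {-1..1}" for s
    by (simp add: strand_points_def curl_def)
  have eq: "(curl ! 0) (-1/2) = (curl ! 0) (1/2)"
    by (simp add: curl_def power2_eq_square)
  have cr: "crosses curl R p q \<longleftrightarrow>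
      (p = (0, -1/2) \<and> q = (0, 1/2) \<or> p = (0, 1/2) \<and> q = (0, -1/2)) \<and> R p q"
    if "p \<in> strand_points curl" "q \<in> strand_points curl" for p q
    using curl_double_points[OF that] eq by (auto simp: crosses_def)
  have const: "\<forall>\<^sub>F y in at x within S. \<phi> (0, y) = \<phi> (0, x)"
    if "x \<in> S" "S \<subseteq> {-1..1}" "\<forall>q \<in> strand_points curl. \<not> crosses curl R q (0, x)" for x S
    using \<phi> that SP[of x] unfolding local_coloring_def
    by (intro eventually_within_subset[OF _ that(2)]) force
  have jump: "jump (\<lambda>s. \<phi> (0, s)) u False (negative_det curl (0, v) (0, u) \<noteq> \<beta> 0) (\<phi> (0, v))"
    if "crosses curl R (0, v) (0, u)" "u \<in> {-1..1}" "v \<in> {-1..1}" for u v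
    using \<phi> that SP unfolding local_coloring_def by fastforce
  define g where "g s = \<phi> (0, s)" for s
  have main: "g (-1) = g 1"
    if cr: "crosses curl R (0, v) (0, u)" and uv: "-1 < u" "u < 1" "v \<in> {-1..1}" "v \<noteq> u"
      and only: "\<And>x q. x \<noteq> u \<Longrightarrow> x \<in> {-1..1} \<Longrightarrow> q \<in> strand_points curl \<Longrightarrow> \<not> crosses curl R q (0, x)" for u v
  proof (rule jump_return[of "{-1..<u}" "{u<..1}" g u])
    show "jump g u False (negative_det curl (0, v) (0, u) \<noteq> \<beta> 0) (g v)"
      using jump[OF cr] uv by (simp add: g_def[abs_def])
    show "\<forall>\<^sub>F y in at x within {-1..<u}. g y = g x" if "x \<in> {-1..<u}" for x
      unfolding g_def by (rule const) (use that uv only in auto)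
    show "\<forall>\<^sub>F y in at x within {u<..1}. g y = g x" if "x \<in> {u<..1}" for x
      unfolding g_def by (rule const) (use that uv only in auto)
    show "\<forall>\<^sub>F y in at_left u. y \<in> {-1..<u}" "\<forall>\<^sub>F y in at_right u. y \<in> {u<..1}"
      using uv by (auto simp: eventually_at_left_field eventually_at_right_field)
  qed (use uv in auto)
  \<comment> \<open>The kinks whose over branch is traversed first or second, and the virtual one.
    By asymmetry of \<open>R\<close> only one preimage of the double point can be an
    undercrossing.\<close>
  consider (neg) "R (0, -1/2) (0, 1/2)" | (pos) "R (0, 1/2) (0, -1/2)"
    | (none) "\<not> R (0, -1/2) (0, 1/2)" "\<not> R (0, 1/2) (0, -1/2)" by blast
  then show ?thesis
  proof cases
    case neg
    then have "g (-1) = g 1" using asym by (intro main[of "-1/2" "1/2"]) (auto simp: cr SP)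
    then show ?thesis by (simp add: g_def)
  next
    case pos
    then have "g (-1) = g 1" using asym
      by (intro main[of "1/2" "-1/2"]) (auto simp: cr SP simp del: eq_divide_eq_numeral1)
    then show ?thesis by (simp add: g_def)
  next
    case none
    have "\<forall>\<^sub>F y in at x within {-1..1}. g y = g x" if "x \<in> {-1..1}" for x
      unfolding g_def by (rule const) (use that none in \<open>auto simp: cr SP simp del: eq_divide_eq_numeral1\<close>)
    then have "g (-1) = g 1"
      by (intro locally_constant_on_connected[of "{-1..1}" g]) auto
    then show ?thesis by (simp add: g_def)
  qed
qed

lemma straight_coloring_ends:
  assumes \<phi>: "local_coloring straight R \<kappa> \<beta> \<phi>"
  shows "\<phi> (0, -1) = \<phi> (0, 1)"
proof -
  have SP: "p \<in> strand_points straight \<longleftrightarrow> (\<exists>s \<in> {-1..1}. p = (0, s))" for p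
    by (cases p) (auto simp: strand_points_def straight_def)
  have nc: "\<not> crosses straight R q p" if "p \<in> strand_points straight" "q \<in> strand_points straight" for p q
    using that by (auto simp: SP crosses_def) (auto simp: straight_def graph_arc_def)
  have "\<forall>\<^sub>F y in at x within {-1..1}. \<phi> (0, y) = \<phi> (0, x)" if "x \<in> {-1..1}" for x
  proof -
    have x: "(0, x) \<in> strand_points straight" using that SP by blast
    then show ?thesis using \<phi> nc[OF x] unfolding local_coloring_def by force
  qed
  then show ?thesis
    by (intro locally_constant_on_connected[of "{-1..1}" "\<lambda>s. \<phi> (0, s)"]) auto
qed

lemma coloring_curl_iff:
  assumes "local_move m curl straight R D D'" "virtual_diagram m D" "virtual_diagram m D'"
    and asym: "\<And>p q. R p q \<Longrightarrow> \<not> R q p"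
  shows "(\<exists>f. coloring m D f) \<longleftrightarrow> (\<exists>f. coloring m D' f)"
proof -
  have len: "length curl = 1" "length straight = 1" by (simp_all add: curl_def straight_def)
  show ?thesis
  proof (rule coloring_move_iff[OF assms(1-3) _ tame_curl tame_straight], goal_cases)
    case 1
    show ?case by (simp add: len)
  next
    case (2 \<kappa> \<beta> \<phi>)
    show ?case
      using curl_coloring_ends[OF 2 asym] local_coloring_const[OF len(2)]
      by (intro exI[of _ "\<lambda>_. \<phi> (0, 1)"]) (simp add: len)
  next
    case (3 \<kappa> \<beta> \<phi>)
    show ?case
      using straight_coloring_ends[OF 3] local_coloring_const[OF len(1)]
      by (intro exI[of _ "\<lambda>_. \<phi> (0, 1)"]) (simp add: len)
  qed
qed

lemma coloring_bigon_iff: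
  assumes "local_move m bigon parallel R D D'" "virtual_diagram m D" "virtual_diagram m D'"
    and "\<And>p q. R p q \<longleftrightarrow> \<rho> (fst p) (fst q)" "\<And>i j. \<rho> i j \<Longrightarrow> \<not> \<rho> j i"
  shows "(\<exists>f. coloring m D f) \<longleftrightarrow> (\<exists>f. coloring m D' f)"
  by (rule coloring_braid_move_iff[OF assms(1-3) _ tame_bigon tame_parallel
        represents_bigon[where R = R and \<rho> = \<rho>, OF assms(4,5)] represents_parallel])
    (simp_all only: bigon_run, simp_all add: bigon_def parallel_def)

lemma coloring_triangle_iff:
  assumes "local_move m triangle_above triangle_below R D D'" "virtual_diagram m D" "virtual_diagram m D'"
    and "\<And>p q. R p q \<longleftrightarrow> \<rho> (fst p) (fst q)" "admissible \<rho>"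
  shows "(\<exists>f. coloring m D f) \<longleftrightarrow> (\<exists>f. coloring m D' f)"
proof -
  have asym: "\<rho> i j \<Longrightarrow> \<not> \<rho> j i" for i j
    using assms(5) unfolding admissible_def by (auto simp: doubleton_eq_iff)
  have len: "length triangle_above = 3" "length triangle_below = 3"
    by (simp_all add: triangle_above_def triangle_below_def)
  show ?thesis
    by (rule coloring_braid_move_iff[OF assms(1-3) _ tame_triangle_above tame_triangle_below
          represents_triangle_above[where R = R and \<rho> = \<rho>, OF assms(4) asym]
          represents_triangle_below[where R = R and \<rho> = \<rho>, OF assms(4) asym]])
      (simp only: len, assumption, assumption, rule triangle_run[OF assms(5)], simp only: len)
qed

section \<open>Invariance under 4-equivalence\<close>

lemma coloring_welded_step:
  assumes "welded_step m D D'" "virtual_diagram m D" "virtual_diagram m D'"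
  shows "(\<exists>f. coloring m D f) \<longleftrightarrow> (\<exists>f. coloring m D' f)"
  using assms(1)
proof cases
  case reparametrization
  then show ?thesis
    using coloring_reparametrized[OF assms(2)] coloring_reparametrized[OF assms(3)] reparametrized_sym
    by blast
next
  case isotopy
  then show ?thesis using coloring_isotopic[OF assms(2)] by simp
next
  case R1_neg
  then show ?thesis by (rule coloring_curl_iff[OF _ assms(2,3)]) simp
next
  case R1_pos
  then show ?thesis by (rule coloring_curl_iff[OF _ assms(2,3)]) simp
next
  case (R2 h)
  show ?thesis
    by (rule coloring_bigon_iff[OF R2(2) assms(2,3), of "\<lambda>i j. h j < h i"]) (auto simp: layered_def)
next
  case (R3 h)
  show ?thesis
    by (rule coloring_triangle_iff[OF R3(2) assms(2,3), of "\<lambda>i j. h j < h i"])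
      (use R3(1) in \<open>auto simp: layered_def admissible_def\<close>)
next
  case V1
  then show ?thesis by (rule coloring_curl_iff[OF _ assms(2,3)]) (simp add: all_virtual_def)
next
  case V2
  then show ?thesis
    by (rule coloring_bigon_iff[OF _ assms(2,3), of _ "\<lambda>i j. False"]) (auto simp: all_virtual_def)
next
  case V3
  then show ?thesis
    by (rule coloring_triangle_iff[OF _ assms(2,3), of _ "\<lambda>i j. False"])
      (auto simp: all_virtual_def admissible_def)
next
  case (mixed k l)
  show ?thesis
    by (rule coloring_triangle_iff[OF mixed(2) assms(2,3), of "\<lambda>i j. i = k \<and> j = l"])
      (use mixed(1) in \<open>auto simp: admissible_def\<close>)
next
  case overcrossings_commute
  then show ?thesis
    by (rule coloring_triangle_iff[OF _ assms(2,3), of _ "\<lambda>i j. i = 2 \<and> j \<in> {0, 1}"])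
      (auto simp: admissible_def)
qed

lemma coloring_four_move:
  assumes "four_move m D D'" "virtual_diagram m D" "virtual_diagram m D'"
  shows "(\<exists>f. coloring m D f) \<longleftrightarrow> (\<exists>f. coloring m D' f)"
proof -
  have len: "length four_twist = length parallel" by (simp add: four_twist_def parallel_def)
  consider "local_move m four_twist parallel (over_slope 1) D D'"
    | "local_move m four_twist parallel (over_slope (-1)) D D'"
    using assms(1) by (auto simp: four_move_def)
  then show ?thesis
  proof cases
    case 1
    show ?thesis
      by (rule coloring_braid_move_iff[OF 1 assms(2,3) len tame_four_twist tame_parallel
            represents_four_twist(1) represents_parallel]) (simp only: four_twist_run, simp)
  next
    case 2
    show ?thesis
      by (rule coloring_braid_move_iff[OF 2 assms(2,3) len tame_four_twist tame_parallel
            represents_four_twist(2) represents_parallel]) (simp only: four_twist_run, simp)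
  qed
qed

lemma coloring_four_equivalence:
  assumes "related_by m (\<lambda>E E'. welded_step m E E' \<or> four_move m E E') D D'"
  shows "(\<exists>f. coloring m D f) \<longleftrightarrow> (\<exists>f. coloring m D' f)"
  using assms unfolding related_by_def
proof (induction rule: equivclp_induct)
  case (step D' D'')
  then show ?case using coloring_welded_step coloring_four_move by blast
qed simp

lemma coloring_welded_equivalence:
  assumes "related_by m (welded_step m) D D'"
  shows "(\<exists>f. coloring m D f) \<longleftrightarrow> (\<exists>f. coloring m D' f)"
  using assms unfolding related_by_def
proof (induction rule: equivclp_induct)
  case (step D' D'')
  then show ?case using coloring_welded_step by blast
qed simp

section \<open>A link without colorings\<close>

definition polar :: "(real \<Rightarrow> real) \<Rightarrow> real \<Rightarrow> complex" where
  "polar r t = of_real (r t) * cis (2 * pi * t)"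

text \<open>The first factor is the velocity in the frame rotating with the point, split into radial
  and tangential parts. Where two polar curves meet at equal angles the frames coincide, so only
  these factors decide the sign of the crossing.\<close>

lemma polar_has_vector_derivative:
  assumes "(r has_real_derivative r') (at t)"
  shows "(polar r has_vector_derivative Complex r' (2 * pi * r t) * cis (2 * pi * t)) (at t)"
  unfolding has_vector_derivative_complex_iff polar_def
  using assms by (auto intro!: derivative_eq_intros simp: algebra_simps)

lemma cis_2pi_eq_iff: "cis (2 * pi * s) = cis (2 * pi * t) \<longleftrightarrow> s - t \<in> \<int>"
proof -
  have "cis (2 * pi * s) = cis (2 * pi * t) \<longleftrightarrow> cis (2 * pi * s) / cis (2 * pi * t) = 1" by simp
  also have "\<dots> \<longleftrightarrow> cis (2 * pi * (s - t)) = 1" by (simp add: cis_divide right_diff_distrib)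
  also have "\<dots> \<longleftrightarrow> cos (2 * pi * (s - t)) = 1"
    by (auto simp: complex_eq_iff cos_one_sin_zero)
  also have "\<dots> \<longleftrightarrow> (\<exists>n :: int. s - t = of_int n)"
    by (auto simp: cos_one_2pi_int)
  also have "\<dots> \<longleftrightarrow> s - t \<in> \<int>" by (auto elim: Ints_cases)
  finally show ?thesis .
qed

lemma polar_eq_iff:
  assumes "r s > 0" "q t > 0"
  shows "polar r s = polar q t \<longleftrightarrow> r s = q t \<and> s - t \<in> \<int>"
proof
  assume e: "polar r s = polar q t"
  then have "norm (polar r s) = norm (polar q t)" by simp
  then have n: "r s = q t" using assms by (simp add: polar_def norm_mult)
  with e have "cis (2 * pi * s) = cis (2 * pi * t)" using assms by (simp add: polar_def)
  with n show "r s = q t \<and> s - t \<in> \<int>" by (simp add: cis_2pi_eq_iff)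
next
  assume "r s = q t \<and> s - t \<in> \<int>"
  then show "polar r s = polar q t" using cis_2pi_eq_iff[of s t] by (simp add: polar_def)
qed

lemma closed_immersion_polar:
  assumes "\<And>t. r t > 0" "\<And>t. r (t + 1) = r t" "\<And>t. (r has_real_derivative r' t) (at t)"
    "continuous_on UNIV r'"
  shows "closed_immersion (polar r)"
proof -
  note d = polar_has_vector_derivative[OF assms(3)]
  have v: "vector_derivative (polar r) (at t) = Complex (r' t) (2 * pi * r t) * cis (2 * pi * t)" for t
    by (rule vector_derivative_at[OF d])
  have "continuous_on UNIV r"
    using assms(3) by (auto intro!: continuous_at_imp_continuous_on DERIV_isCont)
  then have "continuous_on UNIV (\<lambda>t. Complex (r' t) (2 * pi * r t) * cis (2 * pi * t))"
    using assms(4) unfolding Complex_eq by (intro continuous_intros)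
  then have "polar r C1_differentiable_on UNIV"
    unfolding C1_differentiable_on_eq v using d by (auto intro: differentiableI_vector)
  moreover have "polar r (t + 1) = polar r t" for t
    using polar_eq_iff[of r "t + 1" r t] assms(1,2) by simp
  moreover have "vector_derivative (polar r) (at t) \<noteq> 0" for t
  proof -
    have "Complex (r' t) (2 * pi * r t) \<noteq> 0" using assms(1)[of t] by (simp add: complex_eq_iff)
    then show ?thesis by (simp add: v)
  qed
  ultimately show ?thesis by (simp add: closed_immersion_def)
qed

text \<open>
  The two curves meet in the points with parameters \<open>(2 k + 1)/12\<close>, at crossings of alternating signs.
  Of the six, component 2 passes over component 1 at \<open>1/12\<close> and \<open>7/12\<close>, component 1 over component 2 at
  \<open>1/4\<close> and \<open>3/4\<close>, and the other two are virtual.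
\<close>

definition lobed :: "real \<Rightarrow> real" where
  "lobed t = 1 + cos (6 * pi * t) / 2"

text \<open>With three lobes, parameters half a turn apart are three steps apart in the alternating
  sequence of signs. Hence the two crossings of each classical pair have opposite signs, and the
  pairs interleave as 1/12 < 1/4 < 7/12 < 3/4. Doubling the parameter identifies the members of a
  pair modulo 1, which gives the offsets 1/2 and 1/6.\<close>

definition lobed_link :: diagram where
  "lobed_link = \<lparr>curve = (\<lambda>i. if i = 1 then polar lobed else polar (\<lambda>_. 1)),
     over = (\<lambda>x y. fst x \<noteq> fst y \<and> snd x - snd y \<in> \<int> \<and>
       2 * snd x - (if fst x = 1 then 1/2 else 1/6) \<in> \<int>)\<rparr>"

section \<open>The lobed curve and the circle as a virtual link diagram\<close>

lemma lobed_pos: "lobed t > 0"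
  unfolding lobed_def using cos_ge_minus_one[of "6 * pi * t"] by linarith

lemma lobed_shift:
  assumes "s - t \<in> \<int>"
  shows "cos (6 * pi * s) = cos (6 * pi * t)" "sin (6 * pi * s) = sin (6 * pi * t)"
proof -
  obtain n where "s - t = of_int n" using assms by (auto elim: Ints_cases)
  then have "s = t + of_int n" by simp
  then have s: "6 * pi * s = 6 * pi * t + 2 * pi * of_int (3 * n)" by (simp add: algebra_simps)
  show "cos (6 * pi * s) = cos (6 * pi * t)" "sin (6 * pi * s) = sin (6 * pi * t)"
    unfolding s by (simp_all add: cos_add sin_add cos_int_2pin sin_int_2pin del: of_int_mult)
qed

lemma lobed_derivative: "(lobed has_real_derivative - 3 * pi * sin (6 * pi * t)) (at t)"
  unfolding lobed_def by (auto intro!: derivative_eq_intros)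

lemma lobed_link_closed_immersion: "closed_immersion (curve lobed_link i)"
proof -
  have "closed_immersion (polar lobed)"
    by (rule closed_immersion_polar[OF lobed_pos _ lobed_derivative])
      (auto simp: lobed_def lobed_shift(1)[of "_ + 1"] intro!: continuous_intros)
  moreover have "closed_immersion (polar (\<lambda>_. 1))"
    by (rule closed_immersion_polar[where r' = "\<lambda>_. 0"]) auto
  ultimately show ?thesis by (simp add: lobed_link_def)
qed

lemma source_2: "x \<in> source 2 \<longleftrightarrow> fst x = 1 \<or> fst x = 2"
  by (cases x) (auto simp: source_def)

lemma lobed_link_at_point_eq_iff:
  assumes "x \<in> source 2" "y \<in> source 2"
  shows "at_point lobed_link x = at_point lobed_link y \<longleftrightarrow>
    snd x - snd y \<in> \<int> \<and> (fst x = fst y \<or> cos (6 * pi * snd x) = 0)"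
proof -
  have c: "snd x - snd y \<in> \<int> \<Longrightarrow> lobed (snd x) = lobed (snd y)"
    using lobed_shift(1) by (simp add: lobed_def)
  have one: "lobed t = 1 \<longleftrightarrow> cos (6 * pi * t) = 0" for t by (simp add: lobed_def)
  show ?thesis
    using assms c lobed_shift(1)[of "snd x" "snd y"]
    by (auto simp: source_2 at_point_def lobed_link_def polar_eq_iff lobed_pos one
        eq_commute[of 1 "lobed _"])
qed

lemma lobed_link_det:
  assumes "s - t \<in> \<int>"
  shows "planar_det (velocity lobed_link (1, s)) (velocity lobed_link (2, t)) =
    - 6 * pi\<^sup>2 * sin (6 * pi * s)"
proof -
  have cis: "cis (2 * pi * s) = cis (2 * pi * t)" using assms cis_2pi_eq_iff by simp
  have "velocity lobed_link (1, s) =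
      Complex (- 3 * pi * sin (6 * pi * s)) (2 * pi * lobed s) * cis (2 * pi * t)"
    using vector_derivative_at[OF polar_has_vector_derivative[OF lobed_derivative]] cis
    by (simp add: velocity_def lobed_link_def)
  moreover have "velocity lobed_link (2, t) = Complex 0 (2 * pi) * cis (2 * pi * t)"
    using vector_derivative_at[OF polar_has_vector_derivative[of "\<lambda>_. 1" 0]]
    by (simp add: velocity_def lobed_link_def)
  \<comment> \<open>A common rotation preserves the determinant.\<close>
  moreover have "planar_det (z * cis a) (w * cis a) = planar_det z w" for z w a
  proof -
    have "planar_det (z * cis a) (w * cis a) = planar_det z w * ((cos a)\<^sup>2 + (sin a)\<^sup>2)"
      unfolding planar_det_def times_complex.simps cis.simps by algebra
    then show ?thesis by simp
  qed
  ultimately have "planar_det (velocity lobed_link (1, s)) (velocity lobed_link (2, t)) =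
      planar_det (Complex (- 3 * pi * sin (6 * pi * s)) (2 * pi * lobed s)) (Complex 0 (2 * pi))"
    by (simp only:)
  then show ?thesis by (simp add: planar_det_def power2_eq_square)
qed

lemma planar_det_swap: "planar_det v w = - planar_det w v"
  by (simp add: planar_det_def)

lemma lobed_link_det':
  assumes "s - t \<in> \<int>"
  shows "planar_det (velocity lobed_link (2, s)) (velocity lobed_link (1, t)) =
    6 * pi\<^sup>2 * sin (6 * pi * s)"
proof -
  have "t - s \<in> \<int>" using Ints_minus[OF assms] by simp
  then show ?thesis
    using lobed_link_det[of t s] lobed_shift(2)[OF assms] by (subst planar_det_swap) simp
qed

lemma cos_zero_imp_sin_nonzero: "cos x = 0 \<Longrightarrow> sin x \<noteq> (0 :: real)"
  using sin_cos_squared_add[of x] by auto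

lemma over_lobed_link_cos:
  assumes "2 * s - (if i then 1/2 else 1/6) \<in> \<int>"
  shows "cos (6 * pi * s) = 0"
proof -
  obtain n where n: "2 * s - (if i then 1/2 else 1/6) = of_int n" using assms by (auto elim: Ints_cases)
  have "6 * pi * s = of_int (6 * n + (if i then 3 else 1)) * (pi / 2)"
  proof -
    have "s = (of_int n + (if i then 1/2 else 1/6)) / 2" using n by simp
    then show ?thesis by (cases i) (simp_all add: algebra_simps add_divide_distrib)
  qed
  moreover have "odd (6 * n + (if i then 3 else 1))" by simp
  ultimately show ?thesis using cos_zero_iff_int by blast
qed

lemma over_lobed_link:
  "over lobed_link x y \<longleftrightarrow> fst x \<noteq> fst y \<and> snd x - snd y \<in> \<int> \<and>
     2 * snd x - (if fst x = 1 then 1/2 else 1/6) \<in> \<int>"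
  by (simp add: lobed_link_def)

lemma Ints_add_right_iff: "b \<in> \<int> \<Longrightarrow> a + b \<in> \<int> \<longleftrightarrow> a \<in> (\<int> :: real set)"
  by (metis Ints_add Ints_diff add_diff_cancel_right')

lemma Ints_double_shift:
  assumes "(s :: real) - t \<in> \<int>"
  shows "2 * s - c \<in> \<int> \<longleftrightarrow> 2 * t - c \<in> \<int>"
proof -
  have "2 * (s - t) \<in> \<int>" using assms by (intro Ints_mult) auto
  moreover have "2 * s - c = (2 * t - c) + 2 * (s - t)" by simp
  ultimately show ?thesis by (simp only: Ints_add_right_iff)
qed

lemma virtual_diagram_lobed_link: "virtual_diagram 2 lobed_link"
proof -
  have trans: "planar_det (velocity lobed_link x) (velocity lobed_link y) \<noteq> 0"
    if "x \<in> source 2" "y \<in> source 2" "\<not> same_point x y" "at_point lobed_link x = at_point lobed_link y" for x y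
  proof -
    have *: "snd x - snd y \<in> \<int>" "fst x \<noteq> fst y" "cos (6 * pi * snd x) = 0"
      using that lobed_link_at_point_eq_iff by (auto simp: same_point_def)
    then have "sin (6 * pi * snd x) \<noteq> 0" using cos_zero_imp_sin_nonzero by blast
    moreover have "x = (1, snd x) \<and> y = (2, snd y) \<or> x = (2, snd x) \<and> y = (1, snd y)"
      using that(1,2) *(2) by (cases x; cases y) (auto simp: source_2)
    ultimately show ?thesis using lobed_link_det[OF *(1)] lobed_link_det'[OF *(1)] by auto
  qed
  have finite: "finite (crossing_points 2 lobed_link)"
  proof (rule finite_subset)
    \<comment> \<open>The cosine vanishes at every crossing, so the radius there is 1 and the
      parameter is a multiple of 1/12; the crossings are twelfth roots of unity.\<close>
    show "crossing_points 2 lobed_link \<subseteq> {z. z ^ 12 = 1}"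
    proof
      fix z assume "z \<in> crossing_points 2 lobed_link"
      then obtain x y where x: "x \<in> source 2" "y \<in> source 2" "\<not> same_point x y"
        "at_point lobed_link x = at_point lobed_link y" and z: "z = at_point lobed_link x"
        by (auto simp: crossing_points_def)
      then have c: "cos (6 * pi * snd x) = 0"
        using lobed_link_at_point_eq_iff by (auto simp: same_point_def)
      then obtain i :: int where "6 * pi * snd x = of_int i * (pi / 2)"
        by (auto simp: cos_zero_iff_int)
      then have "snd x = of_int i / 12" by simp
      then have "12 * (2 * pi * snd x) = 2 * pi * of_int i" by simp
      moreover have "z = cis (2 * pi * snd x)"
        using c z by (auto simp: at_point_def lobed_link_def polar_def lobed_def)
      then have "z ^ 12 = cis (12 * (2 * pi * snd x))"
        using Complex.DeMoivre[of "2 * pi * snd x" 12] by simp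
      ultimately have "z ^ 12 = cis (2 * pi * of_int i)" by (simp only:)
      also have "\<dots> = 1" by (simp add: complex_eq_iff cos_int_2pin sin_int_2pin)
      finally show "z \<in> {z. z ^ 12 = 1}" by simp
    qed
    show "finite {z :: complex. z ^ 12 = 1}" by (rule finite_roots_unity) simp
  qed
  have triple: "same_point x y \<or> same_point y z \<or> same_point x z"
    if "x \<in> source 2" "y \<in> source 2" "z \<in> source 2" "at_point lobed_link x = at_point lobed_link y"
      "at_point lobed_link y = at_point lobed_link z" for x y z
  proof -
    have "snd x - snd y \<in> \<int>" "snd y - snd z \<in> \<int>" "snd x - snd z \<in> \<int>"
      using lobed_link_at_point_eq_iff[OF that(1,2)] lobed_link_at_point_eq_iff[OF that(2,3)]
        lobed_link_at_point_eq_iff[OF that(1,3)] that(4,5) by simp_all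
    then show ?thesis using that(1-3) by (auto simp: source_2 same_point_def)
  qed
  have over: "\<not> same_point x y \<and> at_point lobed_link x = at_point lobed_link y \<and> \<not> over lobed_link y x"
    if "x \<in> source 2" "y \<in> source 2" "over lobed_link x y" for x y
  proof -
    have o: "fst x \<noteq> fst y" "snd x - snd y \<in> \<int>" "2 * snd x - (if fst x = 1 then 1/2 else 1/6) \<in> \<int>"
      using that(3) by (auto simp: over_lobed_link)
    have "\<not> over lobed_link y x"
    proof
      assume "over lobed_link y x"
      then have "2 * snd x - (if fst y = 1 then 1/2 else 1/6) \<in> \<int>"
        using Ints_double_shift[OF o(2)] by (simp add: over_lobed_link)
      then have "2 * snd x - 1/2 \<in> \<int>" "2 * snd x - 1/6 \<in> \<int>"
        using o(1,3) that(1,2) by (auto simp: source_2 split: if_splits)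
      from Ints_diff[OF this(2,1)] have "(1/3 :: real) \<in> \<int>" by simp
      then obtain n :: int where "1/3 = (of_int n :: real)" by (auto elim: Ints_cases)
      then have "of_int (3 * n) = (1 :: real)" by simp
      then have "3 * n = 1" by (simp only: of_int_eq_1_iff)
      then show False by presburger
    qed
    then show ?thesis
      using o that(1,2) over_lobed_link_cos[OF o(3)] lobed_link_at_point_eq_iff
      by (auto simp: same_point_def)
  qed
  have periodic: "over lobed_link x y = over lobed_link x' y'"
    if "same_point x x'" "same_point y y'" for x x' y y'
  proof -
    have d: "snd x - snd x' \<in> \<int>" "snd y - snd y' \<in> \<int>" and f: "fst x = fst x'" "fst y = fst y'"
      using that by (auto simp: same_point_def)
    have "(snd x - snd x') - (snd y - snd y') \<in> \<int>" by (rule Ints_diff[OF d])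
    moreover have "snd x - snd y = (snd x' - snd y') + ((snd x - snd x') - (snd y - snd y'))" by simp
    ultimately have "snd x - snd y \<in> \<int> \<longleftrightarrow> snd x' - snd y' \<in> \<int>"
      by (simp only: Ints_add_right_iff)
    then show ?thesis using Ints_double_shift[OF d(1)] f by (simp add: over_lobed_link)
  qed
  show ?thesis
    unfolding virtual_diagram_def
    using lobed_link_closed_immersion finite trans triple over periodic by blast
qed

section \<open>Linking numbers\<close>

lemma sin_odd_multiples:
  "sin (3 * pi / 2) = - 1" "sin (7 * pi / 2) = - 1" "sin (9 * pi / 2) = 1"
proof -
  have e: "3 * pi / 2 = 3/2 * pi" "7 * pi / 2 = 3/2 * pi + 2 * pi" "9 * pi / 2 = pi / 2 + 2 * pi + 2 * pi"
    by simp_all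
  show "sin (3 * pi / 2) = - 1" "sin (7 * pi / 2) = - 1" "sin (9 * pi / 2) = 1"
    unfolding e by (simp_all only: sin_periodic sin_pi_half sin_3over2_pi)
qed

lemma lk_lobed_link_1_2: "lk lobed_link 1 2 = 0"
proof -
  have "{(s, t). s \<in> {0..<1} \<and> t \<in> {0..<1} \<and> over lobed_link (1, s) (2, t)} = {(1/4, 1/4), (3/4, 3/4)}"
    (is "?S = ?T")
  proof (intro subset_antisym subsetI)
    fix p assume "p \<in> ?S"
    then obtain s t where p: "p = (s, t)" "0 \<le> s" "s < 1" "0 \<le> t" "t < 1"
      and i: "s - t \<in> \<int>" "2 * s - 1/2 \<in> \<int>" by (auto simp: over_lobed_link)
    obtain n where n: "s - t = of_int n" using i by (auto elim: Ints_cases)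
    then have "n = 0" using p by linarith
    then have "s = t" using n by simp
    obtain k where k: "2 * s - 1/2 = of_int k" using i by (auto elim: Ints_cases)
    then have "k = 0 \<or> k = 1" using p by linarith
    then have "s = 1/4 \<or> s = 3/4" using k by auto
    then show "p \<in> ?T" using p(1) \<open>s = t\<close> by blast
  next
    fix p assume "p \<in> ?T"
    then show "p \<in> ?S" by (auto simp: over_lobed_link)
  qed
  then show ?thesis
    by (simp add: lk_def crossing_sign_def lobed_link_det sin_odd_multiples del: One_nat_def)
qed

lemma lk_lobed_link_2_1: "lk lobed_link 2 1 = 0"
proof -
  have "{(s, t). s \<in> {0..<1} \<and> t \<in> {0..<1} \<and> over lobed_link (2, s) (1, t)} = {(1/12, 1/12), (7/12, 7/12)}"
    (is "?S = ?T")
  proof (intro subset_antisym subsetI)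
    fix p assume "p \<in> ?S"
    then obtain s t where p: "p = (s, t)" "0 \<le> s" "s < 1" "0 \<le> t" "t < 1"
      and i: "s - t \<in> \<int>" "2 * s - 1/6 \<in> \<int>" by (auto simp: over_lobed_link)
    obtain n where n: "s - t = of_int n" using i by (auto elim: Ints_cases)
    then have "n = 0" using p by linarith
    then have "s = t" using n by simp
    obtain k where k: "2 * s - 1/6 = of_int k" using i by (auto elim: Ints_cases)
    then have "k = 0 \<or> k = 1" using p by linarith
    then have "s = 1/12 \<or> s = 7/12" using k by auto
    then show "p \<in> ?T" using p(1) \<open>s = t\<close> by blast
  next
    fix p assume "p \<in> ?T"
    then show "p \<in> ?S" by (auto simp: over_lobed_link)
  qed
  then show ?thesis
    by (simp add: lk_def crossing_sign_def lobed_link_det' sin_odd_multiples del: One_nat_def)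
qed

section \<open>The obstruction\<close>

lemma jump_value:
  assumes "jump f t i d w" "a < t" "t < b"
    and "\<And>s. a < s \<Longrightarrow> s < t \<Longrightarrow> f s = u" "\<And>s. t < s \<Longrightarrow> s < b \<Longrightarrow> f s = v"
  shows "v = act i d u w"
proof -
  obtain c where c: "\<forall>\<^sub>F s in at_left t. f s = c" "\<forall>\<^sub>F s in at_right t. f s = act i d c w"
    using assms(1) by (auto simp: jump_def)
  have "\<forall>\<^sub>F s in at_left t. f s = u" "\<forall>\<^sub>F s in at_right t. f s = v"
    using assms(2-5) by (auto simp: eventually_at_left_field eventually_at_right_field)
  from eventually_conj[OF c(1) this(1)] eventually_conj[OF c(2) this(2)]
  have "\<exists>s. f s = c \<and> f s = u" "\<exists>s. f s = act i d c w \<and> f s = v"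
    using eventually_happens'[OF trivial_limit_at_left_real] eventually_happens'[OF trivial_limit_at_right_real]
    by blast+
  then show ?thesis by auto
qed

text \<open>The passage is the one of a 4-move between different components, except that the two
  undercrossings of the first strand have opposite signs. The sign term then enters once instead of
  twice or never, and \<open>r\<close> changes.\<close>

lemma act_obstruction:
  "act True True (act True False u w) (act True False w (act True False u w)) \<noteq> u"
  by (cases u; cases w) (auto simp: act_def)

lemma not_coloring_lobed_link: "\<not> coloring 2 lobed_link f"
proof
  assume f: "coloring 2 lobed_link f"
  \<comment> \<open>\<open>a\<close> and \<open>a + 1/2\<close> are consecutive undercrossings: 1/12
    modulo 1/2 on component 1, and 1/4 modulo 1/2 on component 2. The offsets are exchanged compared
    with \<open>over\<close>, which tests the component of the over branch.\<close>
  have const: "f (i, s) = f (i, t)"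
    if "i \<in> {1, 2}" "s \<in> {a<..<a + 1/2}" "t \<in> {a<..<a + 1/2}" "2 * a - (if i = 1 then 1/6 else 1/2) \<in> \<int>"
    for i s t a
  proof (rule locally_constant_on_connected[of "{a<..<a + 1/2}" "\<lambda>s. f (i, s)"])
    fix x assume x: "x \<in> {a<..<a + 1/2}"
    have "\<not> over lobed_link y (i, x)" if y: "y \<in> source 2" for y
    proof
      assume o: "over lobed_link y (i, x)"
      then have "2 * x - (if fst y = 1 then 1/2 else 1/6) \<in> \<int>"
        using Ints_double_shift by (auto simp: over_lobed_link)
      then have "2 * x - (if i = 1 then 1/6 else 1/2) \<in> \<int>"
        using o y \<open>i \<in> {1, 2}\<close> by (auto simp: over_lobed_link source_2 split: if_splits)
      from Ints_diff[OF this \<open>2 * a - _ \<in> \<int>\<close>] have "2 * (x - a) \<in> \<int>" by (simp add: algebra_simps)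
      then obtain n where "2 * (x - a) = of_int n" by (auto elim: Ints_cases)
      then have "0 < (of_int n :: real)" "of_int n < (1 :: real)" using x by auto
      then show False by simp
    qed
    then have "\<forall>\<^sub>F t in at x. f (i, t) = f (i, x)"
      using coloringD(2)[OF f, of "(i, x)"] \<open>i \<in> {1, 2}\<close> by (auto simp: source_2)
    then show "\<forall>\<^sub>F t in at x within {a<..<a + 1/2}. f (i, t) = f (i, x)"
      by (rule eventually_within_subset) simp
  qed (use that in auto)
  have c1: "f (1, s) = f (1, 0)" if "-5/12 < s" "s < 1/12" for s
    by (rule const[where a = "-5/12"]) (use that in auto)
  have c2: "f (1, s) = f (1, 1/4)" if "1/12 < s" "s < 7/12" for s
    by (rule const[where a = "1/12"]) (use that in auto)
  have period: "f (1, 1) = f (1, 0)"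
    using coloringD(1)[OF f, of "(1, 1)" "(1, 0)"] by (simp add: source_2 same_point_def)
  \<comment> \<open>This arc contains the parameter 1, which is the same point as 0, so component 1
    closes up to its initial color.\<close>
  have c3: "f (1, s) = f (1, 0)" if "7/12 < s" "s < 13/12" for s
    unfolding period[symmetric] by (rule const[where a = "7/12"]) (use that in auto)
  have c4: "f (2, s) = f (2, 1/12)" if "-1/4 < s" "s < 1/4" for s
    by (rule const[where a = "-1/4"]) (use that in auto)
  have c5: "f (2, s) = f (2, 7/12)" if "1/4 < s" "s < 3/4" for s
    by (rule const[where a = "1/4"]) (use that in auto)
  have j1: "jump (\<lambda>t. f (1, t)) (1/12) True False (f (2, 1/12))"
    using coloringD(3)[OF f, of "(1, 1/12)" "(2, 1/12)"] lobed_link_det'[of "1/12" "1/12"]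
    by (simp add: source_2 over_lobed_link sin_odd_multiples del: One_nat_def)
  have j2: "jump (\<lambda>t. f (1, t)) (7/12) True True (f (2, 7/12))"
    using coloringD(3)[OF f, of "(1, 7/12)" "(2, 7/12)"] lobed_link_det'[of "7/12" "7/12"]
    by (simp add: source_2 over_lobed_link sin_odd_multiples del: One_nat_def)
  have j3: "jump (\<lambda>t. f (2, t)) (1/4) True False (f (1, 1/4))"
    using coloringD(3)[OF f, of "(2, 1/4)" "(1, 1/4)"] lobed_link_det[of "1/4" "1/4"]
    by (simp add: source_2 over_lobed_link sin_odd_multiples del: One_nat_def)
  \<comment> \<open>One turn along component 1: under component 2 at 1/12 and, with the opposite
    sign, at 7/12. In between, component 2 has changed its own color by passing under component 1 at
    1/4.\<close>
  have e1: "f (1, 1/4) = act True False (f (1, 0)) (f (2, 1/12))"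
    by (rule jump_value[OF j1, where a = "-5/12" and b = "7/12", OF _ _ c1 c2]) simp_all
  have e2: "f (1, 0) = act True True (f (1, 1/4)) (f (2, 7/12))"
    by (rule jump_value[OF j2, where a = "1/12" and b = "13/12", OF _ _ c2 c3]) simp_all
  have e3: "f (2, 7/12) = act True False (f (2, 1/12)) (f (1, 1/4))"
    by (rule jump_value[OF j3, where a = "-1/4" and b = "3/4", OF _ _ c4 c5]) simp_all
  show False
    using act_obstruction[of "f (1, 0)" "f (2, 1/12)"]
    unfolding e1[symmetric] e3[symmetric] e2[symmetric] by (rule notE) (rule refl)
qed

theorem proposition4p1:
  shows "\<exists>L \<in> welded_links 2.
    (\<exists>D \<in> L. lk D 1 2 = 0 \<and> lk D 2 1 = 0) \<and> \<not> four_equivalent 2 L (trivial_link 2)"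
proof (intro bexI conjI)
  let ?L = "welded_rel 2 `` {lobed_link}"
  show "lobed_link \<in> ?L"
    using virtual_diagram_lobed_link by (simp add: welded_rel_def related_by_def)
  show "lk lobed_link 1 2 = 0" "lk lobed_link 2 1 = 0"
    by (rule lk_lobed_link_1_2 lk_lobed_link_2_1)+
  show "?L \<in> welded_links 2"
    unfolding welded_links_def by (rule quotientI) (simp add: virtual_diagram_lobed_link)
  \<comment> \<open>Without undercrossings, every constant map is a coloring.\<close>
  have unlink: "coloring 2 unlink_diagram (\<lambda>_. undefined)"
    by (simp add: coloring_def unlink_diagram_def)
  show "\<not> four_equivalent 2 ?L (trivial_link 2)"
  proof
    assume "four_equivalent 2 ?L (trivial_link 2)"
    then obtain D D' where D: "related_by 2 (welded_step 2) lobed_link D"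
      "related_by 2 (\<lambda>E E'. welded_step 2 E E' \<or> four_move 2 E E') D D'"
      "related_by 2 (welded_step 2) unlink_diagram D'"
      by (auto simp: four_equivalent_def trivial_link_def welded_rel_def)
    \<comment> \<open>The diagrams joined by 4-equivalence are arbitrary members of the two classes,
      so welded equivalences at both ends complete the chain from the trivial diagram.\<close>
    have "\<exists>f. coloring 2 lobed_link f"
      using coloring_welded_equivalence[OF D(1)] coloring_four_equivalence[OF D(2)]
        coloring_welded_equivalence[OF D(3)] unlink by blast
    then show False using not_coloring_lobed_link by blast
  qed
qed

end
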